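(* Let $P(\lambda)=\sum_{i=0}^d\lambda^iA_i$ be a regular $n\times n$ matrix polynomial of degree $d$ with complex coefficients, let $\epsilon,\eta\ge0$ be integers with $d=\epsilon+\eta+1$, and let \[ L(\lambda)=A-\lambda B=\left[\begin{array}{c|c} M(\lambda) & L_\eta(\lambda)^T\otimes I_n\\ \hline L_\epsilon(\lambda)\otimes I_n & 0\end{array}\right] \] be a block Kronecker linearization of $P(\lambda)$. Let $(\lambda_0,x)$ and $(\widetilde\lambda_0,\widetilde x)$ be, respectively, exact and approximate eigenpairs of $P(\lambda)$. Assume that $x$ and $\widetilde x$ are unit vectors ($\|x\|_2=\|\widetilde x\|_2=1$). Suppose that the linearization $L(\lambda)=A-\lambda B$ has a generalized Schur form \[ Q^*BZ=\begin{bmatrix}\alpha & b^*\\ 0 & B_1\end{bmatrix}\quad\mbox{and}\quad Q^*AZ=\begin{bmatrix}\beta & a^*\\ 0 & A_1\end{bmatrix}\quad\mbox{with}\quad \lambda_0=\frac{\beta}{\alpha}, \] where $Q$ and $Z$ are unitary, $\alpha,\beta$ are scalars, and $A_1$ and $B_1$ are upper triangular. Then \[ \sin\angle(x,\widetilde x)\le\frac{\|P(\widetilde\lambda_0)\widetilde x\|_2}{\max\left\{1,|\widetilde\lambda_0|^{d-1}\right\}\cdot\mathrm{sep}\,(\widetilde\lambda_0,(A_1,B_1))}. \]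
   Context: A matrix polynomial $P(\lambda)$ is regular if $\det P(\lambda)\not\equiv0$. An (exact) eigenpair of $P(\lambda)$ is a pair $(\lambda_0,x)$ with $x\neq0$ and $P(\lambda_0)x=0$; an approximate eigenpair is a given pair $(\widetilde\lambda_0,\widetilde x)\in\mathbb{C}\times\mathbb{C}^n$ regarded as an approximation of the exact eigenpair $(\lambda_0,x)$. A pencil is a matrix polynomial of degree at most 1. For $k\ge0$, \[ L_k(\lambda):=\begin{bmatrix}-1&\lambda&0&\cdots&0\\0&-1&\lambda&\ddots&\vdots\\\vdots&\ddots&\ddots&\ddots&0\\0&\cdots&0&-1&\lambda\end{bmatrix}\in\mathbb{C}[\lambda]^{k\times(k+1)},\qquad \Lambda_k(\lambda):=\begin{bmatrix}\lambda^k\\\vdots\\\lambda\\1\end{bmatrix} \] (for $k=0$, $L_0$ is empty, with zero rows). A block Kronecker linearization of an $n\times n$ matrix polynomial $P(\lambda)$ of degree $d=\epsilon+\eta+1$ is a $dn\times dn$ pencil $\left[\begin{array}{c|c} M(\lambda) & L_\eta(\lambda)^T\otimes I_n\\ \hline L_\epsilon(\lambda)\otimes I_n & 0\end{array}\right]$, where $M(\lambda)$ is an $(\eta+1)n\times(\epsilon+1)n$ pencil satisfying $(\Lambda_\eta(\lambda)^T\otimes I_n)M(\lambda)(\Lambda_\epsilon(\lambda)\otimes I_n)=P(\lambda)$. The acute angle between nonzero $u,w\in\mathbb{C}^n$ is $\angle(u,w):=\arccos\left(\frac{|w^*u|}{\|u\|_2\|w\|_2}\right)$. The separation is $\mathrm{sep}(\lambda,(A,B)):=\|(A-\lambda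 B)^{-1}\|_2^{-1}=\sigma_{\min}(A-\lambda B)$, the smallest singular value of $A-\lambda B$.
   Formalization: Added: α≠0; A_1−λ̃_0B_1 is invertible (sep≠0); and either the eigenspace of P at λ_0 is spanned by x, or the eigenvector of P recovered from the first column of Z is a multiple of x. Without the last, the claim fails for a multiple eigenvalue λ_0. *)

theory Defs
  imports "Jordan_Normal_Form.Schur_Decomposition"
begin

section \<open>Matrix polynomials\<close>

definition matrix_poly :: "nat \<Rightarrow> nat \<Rightarrow> (nat \<Rightarrow> complex mat) \<Rightarrow> complex poly mat" where
  "matrix_poly n d C = mat n n (\<lambda>(r, c). \<Sum>i\<le>d. monom (C i $$ (r, c)) i)"

definition eval_mat :: "complex poly mat \<Rightarrow> complex \<Rightarrow> complex mat" where
  "eval_mat P \<mu> = map_mat (\<lambda>p. poly p \<mu>) P"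

definition regular_mat_poly :: "complex poly mat \<Rightarrow> bool" where
  "regular_mat_poly P \<longleftrightarrow> square_mat P \<and> det P \<noteq> 0"

definition eigenpair :: "complex poly mat \<Rightarrow> complex \<Rightarrow> complex vec \<Rightarrow> bool" where
  "eigenpair P \<mu> x \<longleftrightarrow> x \<in> carrier_vec (dim_col P) \<and> x \<noteq> 0\<^sub>v (dim_col P)
     \<and> eval_mat P \<mu> *\<^sub>v x = 0\<^sub>v (dim_row P)"

definition is_pencil :: "complex poly mat \<Rightarrow> bool" where
  "is_pencil M \<longleftrightarrow> (\<forall>i < dim_row M. \<forall>j < dim_col M. degree (M $$ (i, j)) \<le> 1)"

definition pencil :: "complex mat \<Rightarrow> complex mat \<Rightarrow> complex poly mat" where
  "pencil A B = map_mat (\<lambda>a. [:a:]) A - map_mat (\<lambda>b. [:0, b:]) B"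


section \<open>Block Kronecker linearizations\<close>

definition kron :: "'a :: semiring_0 mat \<Rightarrow> 'a mat \<Rightarrow> 'a mat" where
  "kron A B = mat (dim_row A * dim_row B) (dim_col A * dim_col B)
     (\<lambda>(i, j). A $$ (i div dim_row B, j div dim_col B) * B $$ (i mod dim_row B, j mod dim_col B))"

definition L_mat :: "nat \<Rightarrow> complex poly mat" where
  "L_mat k = mat k (k + 1) (\<lambda>(i, j). if j = i then -1 else if j = i + 1 then [:0, 1:] else 0)"

definition Lambda_mat :: "nat \<Rightarrow> complex poly mat" where
  "Lambda_mat k = mat (k + 1) 1 (\<lambda>(i, _). monom 1 (k - i))"

definition is_block_kronecker_linearization ::
    "nat \<Rightarrow> nat \<Rightarrow> nat \<Rightarrow> complex poly mat \<Rightarrow> complex poly mat \<Rightarrow> bool" where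
  "is_block_kronecker_linearization n \<epsilon> \<eta> P L \<longleftrightarrow>
     (\<exists>M. M \<in> carrier_mat ((\<eta> + 1) * n) ((\<epsilon> + 1) * n) \<and> is_pencil M
        \<and> kron ((Lambda_mat \<eta>)\<^sup>T) (1\<^sub>m n) * M * kron (Lambda_mat \<epsilon>) (1\<^sub>m n) = P
        \<and> L = four_block_mat M (kron ((L_mat \<eta>)\<^sup>T) (1\<^sub>m n))
                (kron (L_mat \<epsilon>) (1\<^sub>m n)) (0\<^sub>m (\<epsilon> * n) (\<eta> * n)))"

text \<open>A null vector of \<open>L(\<mu>)\<close> has the form \<open>(\<Lambda>\<^sub>\<epsilon>(\<mu>) \<otimes> x, y)\<close> with \<open>P(\<mu>) x = 0\<close>. Since the
  last entry of \<open>\<Lambda>\<^sub>\<epsilon>\<close> is 1, the eigenvector \<open>x\<close> of \<open>P\<close> is the block with index \<open>\<epsilon>\<close> (counting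
  from 0).\<close>
definition recovered_vec :: "nat \<Rightarrow> nat \<Rightarrow> complex vec \<Rightarrow> complex vec" where
  "recovered_vec n \<epsilon> z = vec n (\<lambda>i. z $ (\<epsilon> * n + i))"


section \<open>Norms, angle, separation\<close>

definition norm2 :: "complex vec \<Rightarrow> real" where
  "norm2 v = sqrt (\<Sum>i < dim_vec v. (cmod (v $ i))\<^sup>2)"

definition acute_angle :: "complex vec \<Rightarrow> complex vec \<Rightarrow> real" where
  "acute_angle u w = arccos (cmod (u \<bullet>c w) / (norm2 u * norm2 w))"

text \<open>The operator 2-norm; the unit ball instead of the unit sphere also covers the empty matrix,
  whose norm is 0.\<close>
definition mat_norm2 :: "complex mat \<Rightarrow> real" where
  "mat_norm2 N = Sup {norm2 (N *\<^sub>v v) | v. v \<in> carrier_vec (dim_col N) \<and> norm2 v \<le> 1}"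

text \<open>For a singular \<open>A - \<mu> B\<close> the value is 0, its smallest singular value.\<close>
definition sep :: "complex \<Rightarrow> complex mat \<Rightarrow> complex mat \<Rightarrow> real" where
  "sep \<mu> A B = (case mat_inverse (A - \<mu> \<cdot>\<^sub>m B) of None \<Rightarrow> 0 | Some N \<Rightarrow> inverse (mat_norm2 N))"


section \<open>Generalized Schur form\<close>

definition unitary_mat :: "nat \<Rightarrow> complex mat \<Rightarrow> bool" where
  "unitary_mat N Q \<longleftrightarrow> Q \<in> carrier_mat N N \<and> mat_adjoint Q * Q = 1\<^sub>m N \<and> Q * mat_adjoint Q = 1\<^sub>m N"

definition bordered_mat :: "complex \<Rightarrow> complex vec \<Rightarrow> complex mat \<Rightarrow> complex mat" where
  "bordered_mat s r T = four_block_mat (mat 1 1 (\<lambda>_. s)) (mat 1 (dim_vec r) (\<lambda>(_, j). cnj (r $ j)))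
     (0\<^sub>m (dim_row T) 1) T"

definition is_generalized_schur_form ::
    "nat \<Rightarrow> complex mat \<Rightarrow> complex mat \<Rightarrow> complex mat \<Rightarrow> complex mat \<Rightarrow> complex \<Rightarrow> complex \<Rightarrow>
     complex vec \<Rightarrow> complex vec \<Rightarrow> complex mat \<Rightarrow> complex mat \<Rightarrow> bool" where
  "is_generalized_schur_form N A B Q Z \<alpha> \<beta> a b A1 B1 \<longleftrightarrow>
     unitary_mat N Q \<and> unitary_mat N Z
     \<and> a \<in> carrier_vec (N - 1) \<and> b \<in> carrier_vec (N - 1)
     \<and> A1 \<in> carrier_mat (N - 1) (N - 1) \<and> upper_triangular A1
     \<and> B1 \<in> carrier_mat (N - 1) (N - 1) \<and> upper_triangular B1
     \<and> mat_adjoint Q * B * Z = bordered_mat \<alpha> b B1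
     \<and> mat_adjoint Q * A * Z = bordered_mat \<beta> a A1"

end

theory Submission
  imports Defs
begin

text \<open>Write \<open>L(\<mu>) = A - \<mu> B\<close>, let \<open>z\<close> be the first column of \<open>Z\<close>, and let block \<open>i\<close> of a vector be its
  entries \<open>i n, \<dots>, i n + n - 1\<close>, which is what \<open>recovered_vec n i\<close> reads off for any \<open>i\<close>. Two vectors
  are compared.

  At the exact eigenvalue, the Schur form gives \<open>L(\<mu>) z = 0\<close>. The kernel of \<open>L\<^sub>\<epsilon>(\<mu>) \<otimes> I\<close> forces
  block \<open>i \<le> \<epsilon>\<close> of \<open>z\<close> to be \<open>\<mu>\<^sup>\<epsilon>\<^sup>-\<^sup>i y\<close> with \<open>P(\<mu>) y = 0\<close>
  (\<open>block_kronecker_null_vector\<close>), so all these blocks are multiples of \<open>x\<close>.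

  At the approximate eigenvalue, \<open>\<Lambda>\<^sub>\<epsilon>(\<mu>') \<otimes> x'\<close> extends to a vector \<open>v\<close> for which \<open>L(\<mu>') v\<close>
  vanishes outside a single block \<open>j \<le> \<eta>\<close>, and there equals \<open>s P(\<mu>') x'\<close> with
  \<open>s \<mu>'\<^sup>\<eta>\<^sup>-\<^sup>j = 1\<close> (\<open>block_kronecker_lift\<close>). The point is that the range of
  \<open>L\<^sub>\<eta>(\<mu>')\<^sup>T \<otimes> I\<close> is the kernel of \<open>\<Lambda>\<^sub>\<eta>(\<mu>')\<^sup>T \<otimes> I\<close>: a residual may be moved between blocks
  as long as its image under \<open>\<Lambda>\<^sub>\<eta>(\<mu>')\<^sup>T \<otimes> I\<close>, namely \<open>P(\<mu>') x'\<close>, is kept.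

  In the coordinates of the Schur form, the part of \<open>v\<close> orthogonal to \<open>z\<close> solves a linear system
  with matrix \<open>A\<^sub>1 - \<mu>' B\<^sub>1\<close>, so the distance of \<open>v\<close> to the line through \<open>z\<close> is at most
  \<open>|s| \<parallel>P(\<mu>') x'\<parallel> / sep\<close> (\<open>dist_to_schur_vector_le\<close>). On block \<open>i\<close> this distance is at least that of
  \<open>\<mu>'\<^sup>\<epsilon>\<^sup>-\<^sup>i x'\<close> to the line through \<open>x\<close>, which is \<open>|\<mu>'|\<^sup>\<epsilon>\<^sup>-\<^sup>i\<close> times the sine of the angle
  (\<open>sin_acute_angle_le_dist\<close>). The choice \<open>i = \<epsilon>\<close>, \<open>j = \<eta>\<close> gives the factor \<open>1\<close> in the denominator,
  and \<open>i = j = 0\<close> gives \<open>|\<mu>'|\<^sup>\<epsilon>\<^sup>+\<^sup>\<eta> = |\<mu>'|\<^sup>d\<^sup>-\<^sup>1\<close>.\<close>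

section \<open>Euclidean norm, operator norm and angle\<close>

lemma norm2_nonneg: "norm2 v \<ge> 0"
  by (simp add: norm2_def sum_nonneg)

lemma norm2_sq: "(norm2 v)\<^sup>2 = (\<Sum>i<dim_vec v. (cmod (v $ i))\<^sup>2)"
  by (simp add: norm2_def sum_nonneg)

lemma norm2_sq_cscalar: "complex_of_real ((norm2 v)\<^sup>2) = v \<bullet>c v"
  by (simp add: norm2_sq scalar_prod_def atLeast0LessThan flip: complex_norm_square)

lemma norm2_smult: "norm2 (c \<cdot>\<^sub>v v) = cmod c * norm2 v"
proof -
  have "(norm2 (c \<cdot>\<^sub>v v))\<^sup>2 = (cmod c * norm2 v)\<^sup>2"
    by (simp add: norm2_sq power_mult_distrib norm_mult sum_distrib_left)
  then show ?thesis
    by (simp add: norm2_nonneg)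
qed

lemma cmod_index_le_norm2:
  assumes "i < dim_vec v"
  shows "cmod (v $ i) \<le> norm2 v"
proof -
  have "(cmod (v $ i))\<^sup>2 \<le> (norm2 v)\<^sup>2"
    unfolding norm2_sq using assms by (intro member_le_sum) auto
  then show ?thesis
    using norm2_nonneg by (rule power2_le_imp_le)
qed

lemma norm2_eq_0_imp:
  assumes "v \<in> carrier_vec n" "norm2 v = 0"
  shows "v = 0\<^sub>v n"
proof (rule eq_vecI)
  fix i assume "i < dim_vec (0\<^sub>v n :: complex vec)"
  then show "v $ i = 0\<^sub>v n $ i"
    using cmod_index_le_norm2[of i v] assms by auto
qed (use assms in auto)

lemma norm2_append: "(norm2 (v @\<^sub>v w))\<^sup>2 = (norm2 v)\<^sup>2 + (norm2 w)\<^sup>2"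
proof -
  have "(\<Sum>i<p + q. f i) = (\<Sum>i<p. f i) + (\<Sum>i<q. f (p + i))" for f :: "nat \<Rightarrow> real" and p q
    by (induction q) (auto simp: add.assoc)
  then show ?thesis
    by (simp add: norm2_sq)
qed

lemma norm2_zero: "norm2 (0\<^sub>v n) = 0"
  by (simp add: norm2_def)

lemma mat_mult_zero_vec:
  fixes N :: "complex mat"
  shows "N \<in> carrier_mat p q \<Longrightarrow> N *\<^sub>v 0\<^sub>v q = 0\<^sub>v p"
  by auto

lemma norm2_mult_vec_le_mat_norm2:
  assumes N: "N \<in> carrier_mat p q" and v: "v \<in> carrier_vec q" "norm2 v \<le> 1"
  shows "norm2 (N *\<^sub>v v) \<le> mat_norm2 N"
proof -
  define S where "S = {norm2 (N *\<^sub>v v) | v. v \<in> carrier_vec (dim_col N) \<and> norm2 v \<le> 1}"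
  \<comment> \<open>The supremum is attained by compactness, but here any bound on the unit ball is enough; the row
    sums of the absolute values give one.\<close>
  have "norm2 (N *\<^sub>v u) \<le> sqrt (\<Sum>i<p. (\<Sum>j<q. cmod (N $$ (i, j)))\<^sup>2)"
    if u: "u \<in> carrier_vec q" "norm2 u \<le> 1" for u
  proof -
    have "cmod ((N *\<^sub>v u) $ i) \<le> (\<Sum>j<q. cmod (N $$ (i, j)))" if i: "i < p" for i
    proof -
      have "(N *\<^sub>v u) $ i = (\<Sum>j<q. N $$ (i, j) * u $ j)"
        using N u i by (simp add: scalar_prod_def atLeast0LessThan)
      also have "cmod \<dots> \<le> (\<Sum>j<q. cmod (N $$ (i, j)))"
      proof (rule sum_norm_le)
        fix j assume "j \<in> {..<q}"
        then have "cmod (u $ j) \<le> 1"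
          using cmod_index_le_norm2[of j u] u by auto
        then show "cmod (N $$ (i, j) * u $ j) \<le> cmod (N $$ (i, j))"
          by (simp add: norm_mult mult_left_le)
      qed
      finally show ?thesis .
    qed
    then show ?thesis
      using N unfolding norm2_def by (auto intro!: sum_mono power_mono)
  qed
  then have bdd: "bdd_above S"
    using N unfolding S_def bdd_above_def by auto
  show ?thesis
    unfolding mat_norm2_def S_def[symmetric]
    by (rule cSup_upper[OF _ bdd]) (use v N in \<open>auto simp: S_def\<close>)
qed

lemma mat_norm2_nonneg:
  assumes N: "N \<in> carrier_mat p q"
  shows "mat_norm2 N \<ge> 0"
  using norm2_mult_vec_le_mat_norm2[OF N, of "0\<^sub>v q"] mat_mult_zero_vec[OF N] by (simp add: norm2_zero)

lemma mat_norm2_bound: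
  assumes N: "N \<in> carrier_mat p q" and v: "v \<in> carrier_vec q"
  shows "norm2 (N *\<^sub>v v) \<le> mat_norm2 N * norm2 v"
proof (cases "norm2 v = 0")
  case True
  then have "v = 0\<^sub>v q"
    using v norm2_eq_0_imp by blast
  then have "N *\<^sub>v v = 0\<^sub>v p"
    using mat_mult_zero_vec[OF N] by simp
  then show ?thesis
    using True by (simp add: norm2_zero)
next
  case False
  define u where "u = complex_of_real (inverse (norm2 v)) \<cdot>\<^sub>v v"
  have u: "u \<in> carrier_vec q" "norm2 u = 1"
    using v False norm2_nonneg[of v] by (auto simp: u_def norm2_smult norm_inverse simp flip: of_real_inverse)
  have "norm2 (N *\<^sub>v u) \<le> mat_norm2 N"
    using norm2_mult_vec_le_mat_norm2[OF N] u by simp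
  moreover have "norm2 (N *\<^sub>v u) = inverse (norm2 v) * norm2 (N *\<^sub>v v)"
    using mult_mat_vec[OF N v] norm2_nonneg[of v] by (simp add: u_def norm2_smult norm_inverse)
  ultimately show ?thesis
    using False norm2_nonneg[of v] by (simp add: field_simps)
qed

lemma norm2_diff_smult_sq:
  assumes u: "u \<in> carrier_vec n" and w: "w \<in> carrier_vec n"
  shows "(norm2 (s \<cdot>\<^sub>v u - c \<cdot>\<^sub>v w))\<^sup>2 =
    (cmod s * norm2 u)\<^sup>2 + (cmod c * norm2 w)\<^sup>2 - 2 * Re (s * cnj c * (u \<bullet>c w))"
proof -
  have *: "(cmod (a - b))\<^sup>2 = (cmod a)\<^sup>2 + (cmod b)\<^sup>2 - 2 * Re (a * cnj b)" for a b
    by (simp only: cmod_power2) (simp add: power2_eq_square algebra_simps)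
  have ip: "u \<bullet>c w = (\<Sum>i<n. u $ i * cnj (w $ i))"
    using u w by (simp add: scalar_prod_def atLeast0LessThan)
  have "(norm2 (s \<cdot>\<^sub>v u - c \<cdot>\<^sub>v w))\<^sup>2 = (\<Sum>i<n. (cmod (s * u $ i - c * w $ i))\<^sup>2)"
    using u w by (simp add: norm2_sq)
  also have "\<dots> = (\<Sum>i<n. (cmod s)\<^sup>2 * (cmod (u $ i))\<^sup>2 + (cmod c)\<^sup>2 * (cmod (w $ i))\<^sup>2
      - 2 * Re (s * cnj c * (u $ i * cnj (w $ i))))"
    by (simp only: * norm_mult power_mult_distrib complex_cnj_mult ac_simps)
  also have "\<dots> = (cmod s * norm2 u)\<^sup>2 + (cmod c * norm2 w)\<^sup>2 - 2 * Re (s * cnj c * (u \<bullet>c w))"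
    using u w by (simp only: ip sum_subtractf sum.distrib sum_distrib_left power_mult_distrib
        norm2_sq carrier_vecD Re_sum)
  finally show ?thesis .
qed

text \<open>Cauchy--Schwarz for unit vectors, which keeps the argument of \<open>arccos\<close> in \<open>acute_angle\<close> within its
  domain: the squared distance from \<open>u\<close> to its projection on \<open>w\<close> is \<open>1 - |w\<^sup>* u|\<^sup>2\<close>.\<close>
lemma cmod_cscalar_prod_unit_le_1:
  assumes u: "u \<in> carrier_vec n" "norm2 u = 1" and w: "w \<in> carrier_vec n" "norm2 w = 1"
  shows "cmod (u \<bullet>c w) \<le> 1"
proof -
  define p where "p = u \<bullet>c w"
  have "0 \<le> (norm2 (1 \<cdot>\<^sub>v u - p \<cdot>\<^sub>v w))\<^sup>2"
    by simp
  also have "\<dots> = 1 + (cmod p)\<^sup>2 - 2 * Re (p * cnj p)"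
    using norm2_diff_smult_sq[OF u(1) w(1), of 1 p] u w by (simp add: p_def mult.commute)
  also have "\<dots> = 1 - (cmod p)\<^sup>2"
    by (simp add: cmod_power2 flip: power2_eq_square)
  finally show ?thesis
    by (simp add: p_def abs_square_le_1)
qed

text \<open>For unit vectors the distance from \<open>s u\<close> to the line through \<open>w\<close> is \<open>|s| sin \<angle>(w, u)\<close>. The
  inequality follows by completing the square: with \<open>t = |w\<^sup>* u|\<close> the squared distance to \<open>c w\<close> is at
  least \<open>|s|\<^sup>2 (1 - t\<^sup>2) + (|c| - |s| t)\<^sup>2\<close>.\<close>
lemma sin_acute_angle_le_dist:
  assumes u: "u \<in> carrier_vec n" "norm2 u = 1" and w: "w \<in> carrier_vec n" "norm2 w = 1"
  shows "cmod s * sin (acute_angle w u) \<le> norm2 (s \<cdot>\<^sub>v u - c \<cdot>\<^sub>v w)"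
proof -
  have comm: "cmod (w \<bullet>c u) = cmod (u \<bullet>c w)"
    using conjugate_conjugate_sprod[of w n u] conjugate_vec_sprod_comm[of u n w] u w
    by (metis carrier_vec_conjugate comm_scalar_prod complex_mod_cnj conjugate_complex_def)
  define t where "t = cmod (u \<bullet>c w)"
  have t: "0 \<le> t" "t \<le> 1"
    using cmod_cscalar_prod_unit_le_1[OF u w] by (auto simp: t_def)
  have "sin (acute_angle w u) = sqrt (1 - t\<^sup>2)"
    using t u w comm by (simp add: acute_angle_def sin_arccos_abs t_def)
  then have "(cmod s * sin (acute_angle w u))\<^sup>2 = (cmod s)\<^sup>2 * (1 - t\<^sup>2)"
    using t by (simp add: power_mult_distrib abs_square_le_1)
  also have "\<dots> \<le> (cmod s)\<^sup>2 * (1 - t\<^sup>2) + (cmod c - cmod s * t)\<^sup>2"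
    by simp
  also have "\<dots> = (cmod s)\<^sup>2 + (cmod c)\<^sup>2 - 2 * (cmod s * cmod c * t)"
    by (simp add: power2_eq_square algebra_simps)
  also have "\<dots> \<le> (cmod s)\<^sup>2 + (cmod c)\<^sup>2 - 2 * Re (s * cnj c * (u \<bullet>c w))"
    using complex_Re_le_cmod[of "s * cnj c * (u \<bullet>c w)"] by (simp add: norm_mult t_def)
  also have "\<dots> = (norm2 (s \<cdot>\<^sub>v u - c \<cdot>\<^sub>v w))\<^sup>2"
    using norm2_diff_smult_sq[OF u(1) w(1)] u w by simp
  finally show ?thesis
    using norm2_nonneg by (rule power2_le_imp_le)
qed

section \<open>Adjoints and the separation\<close>

lemma mat_adjoint_carrier:
  "A \<in> carrier_mat p q \<Longrightarrow> mat_adjoint A \<in> carrier_mat q p"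
  by (auto simp: mat_adjoint_def)

lemma mat_adjoint_index:
  "A \<in> carrier_mat p q \<Longrightarrow> i < q \<Longrightarrow> j < p \<Longrightarrow> mat_adjoint A $$ (i, j) = conjugate (A $$ (j, i))"
  by (auto simp: mat_adjoint_def mat_of_rows_def)

lemma cscalar_prod_adjoint:
  fixes A :: "complex mat"
  assumes A: "A \<in> carrier_mat p q" and v: "v \<in> carrier_vec q" and w: "w \<in> carrier_vec p"
  shows "(A *\<^sub>v v) \<bullet>c w = v \<bullet>c (mat_adjoint A *\<^sub>v w)"
proof -
  have "(A *\<^sub>v v) \<bullet>c w = (\<Sum>i<p. \<Sum>j<q. A $$ (i, j) * v $ j * cnj (w $ i))"
    using A v w by (simp add: scalar_prod_def atLeast0LessThan sum_distrib_right)
  also have "\<dots> = (\<Sum>j<q. \<Sum>i<p. A $$ (i, j) * v $ j * cnj (w $ i))"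
    by (rule sum.swap)
  also have "\<dots> = v \<bullet>c (mat_adjoint A *\<^sub>v w)"
    using A v w mat_adjoint_carrier[OF A] mat_adjoint_index[OF A]
    by (simp add: scalar_prod_def atLeast0LessThan sum_distrib_left ac_simps)
  finally show ?thesis .
qed

lemma norm2_isometry:
  assumes U: "U \<in> carrier_mat p q" and iso: "mat_adjoint U * U = 1\<^sub>m q" and v: "v \<in> carrier_vec q"
  shows "norm2 (U *\<^sub>v v) = norm2 v"
proof -
  have "(U *\<^sub>v v) \<bullet>c (U *\<^sub>v v) = v \<bullet>c (mat_adjoint U *\<^sub>v (U *\<^sub>v v))"
    using U v by (intro cscalar_prod_adjoint) auto
  also have "mat_adjoint U *\<^sub>v (U *\<^sub>v v) = v"
    using assoc_mult_mat_vec[OF mat_adjoint_carrier[OF U] U v] iso v by simp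
  finally have "(norm2 (U *\<^sub>v v))\<^sup>2 = (norm2 v)\<^sup>2"
    by (metis norm2_sq_cscalar of_real_eq_iff)
  then show ?thesis
    by (simp add: norm2_nonneg)
qed

text \<open>For an empty matrix \<open>mat_norm2 N = 0\<close>, so \<open>sep\<close> is the default value \<open>inverse 0 = 0\<close>. Keeping
  \<open>sep\<close> in the form \<open>inverse (mat_norm2 N)\<close> makes division by it a multiplication by \<open>mat_norm2 N\<close> even
  then.\<close>
lemma sep_invertible:
  assumes A: "A \<in> carrier_mat m m" and B: "B \<in> carrier_mat m m"
    and inv: "invertible_mat (A - \<mu> \<cdot>\<^sub>m B)"
  obtains N where "N \<in> carrier_mat m m" "N * (A - \<mu> \<cdot>\<^sub>m B) = 1\<^sub>m m"
    "sep \<mu> A B = inverse (mat_norm2 N)"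
proof -
  let ?F = "A - \<mu> \<cdot>\<^sub>m B"
  have F: "?F \<in> carrier_mat m m"
    using A B by auto
  obtain N where N: "?F * N = 1\<^sub>m (dim_row ?F)" "N * ?F = 1\<^sub>m (dim_row N)"
    using inv by (auto simp: invertible_mat_def inverts_mat_def)
  have "dim_row N = m" "dim_col N = m"
    using F arg_cong[OF N(1), of dim_col] arg_cong[OF N(2), of dim_col] by auto
  then have "N \<in> carrier_mat m m"
    by auto
  then have "?F \<in> Units (ring_mat TYPE(complex) m ())"
    using N F \<open>dim_row N = m\<close> carrier_matD(1)[OF F] unfolding Units_def ring_mat_def by auto
  then obtain K where K: "mat_inverse ?F = Some K"
    using mat_inverse(1)[OF F, of "()"] by (cases "mat_inverse ?F") auto
  show ?thesis
    using that[of K] mat_inverse(2)[OF F K] K by (simp add: sep_def)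
qed

section \<open>Kronecker products with the identity, blockwise\<close>

lemma block_index_less:
  fixes i r n m :: nat
  assumes "i < m" "r < n"
  shows "i * n + r < m * n"
proof -
  have "i * n + r < (i + 1) * n"
    using assms by simp
  also have "\<dots> \<le> m * n"
    using assms by (intro mult_le_mono1) simp
  finally show ?thesis .
qed

lemma sum_blocks: "(\<Sum>l<m * n. f l) = (\<Sum>j<m. \<Sum>r<n. f (j * n + r))"
  for f :: "nat \<Rightarrow> 'a :: comm_monoid_add"
proof -
  have "sum f {j * n..<j * n + n} = (\<Sum>r<n. f (j * n + r))" for j
    using sum.shift_bounds_nat_ivl[of f 0 "j * n" n] by (simp add: atLeast0LessThan add.commute)
  then show ?thesis
    using sum.nat_group[of f n m] by simp
qed

lemma eq_vec_blocksI:
  assumes v: "v \<in> carrier_vec (m * n)" and w: "w \<in> carrier_vec (m * n)"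
    and eq: "\<And>i r. i < m \<Longrightarrow> r < n \<Longrightarrow> v $ (i * n + r) = w $ (i * n + r)"
  shows "v = w"
proof (rule eq_vecI)
  fix k assume "k < dim_vec w"
  then have k: "k < m * n"
    using w by simp
  then have "n > 0"
    by (cases n) auto
  then have "k div n < m" "k mod n < n"
    using k by (auto simp: less_mult_imp_div_less)
  from eq[OF this] show "v $ k = w $ k"
    by simp
qed (use v w in auto)

text \<open>\<open>K \<otimes> I\<close> acts on vectors of blocks as \<open>K\<close> acts on vectors of scalars: it never mixes the
  positions \<open>r\<close> within a block. All facts about \<open>L\<^sub>k \<otimes> I\<close> and \<open>\<Lambda>\<^sub>k \<otimes> I\<close> below are thereby
  statements about scalar sequences.\<close>
lemma kron_id_mult_vec:
  fixes K :: "'a :: comm_ring_1 mat"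
  assumes K: "K \<in> carrier_mat p q" and v: "v \<in> carrier_vec (q * n)" and i: "i < p" and r: "r < n"
  shows "(kron K (1\<^sub>m n) *\<^sub>v v) $ (i * n + r) = (\<Sum>j<q. K $$ (i, j) * v $ (j * n + r))"
proof -
  have n: "n > 0"
    using r by simp
  have "(kron K (1\<^sub>m n) *\<^sub>v v) $ (i * n + r)
      = (\<Sum>l<q * n. K $$ (i, l div n) * 1\<^sub>m n $$ (r, l mod n) * v $ l)"
    using K v i r n block_index_less[OF i r]
    by (simp add: kron_def scalar_prod_def atLeast0LessThan)
  also have "\<dots> = (\<Sum>j<q. \<Sum>l<n. K $$ (i, j) * 1\<^sub>m n $$ (r, l) * v $ (j * n + l))"
    by (simp add: sum_blocks)
  also have "\<dots> = (\<Sum>j<q. K $$ (i, j) * v $ (j * n + r))"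
  proof (rule sum.cong[OF refl])
    fix j
    have "(\<Sum>l<n. K $$ (i, j) * 1\<^sub>m n $$ (r, l) * v $ (j * n + l))
        = (\<Sum>l<n. if l = r then K $$ (i, j) * v $ (j * n + l) else 0)"
      using r by (intro sum.cong) auto
    then show "(\<Sum>l<n. K $$ (i, j) * 1\<^sub>m n $$ (r, l) * v $ (j * n + l)) = K $$ (i, j) * v $ (j * n + r)"
      using r by simp
  qed
  finally show ?thesis .
qed

lemma kron_carrier:
  "K \<in> carrier_mat p q \<Longrightarrow> kron K (1\<^sub>m n) \<in> carrier_mat (p * n) (q * n)"
  by (auto simp: kron_def)

lemma eval_mat_carrier: "K \<in> carrier_mat p q \<Longrightarrow> eval_mat K \<mu> \<in> carrier_mat p q"
  by (auto simp: eval_mat_def)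

lemma eval_mat_mult:
  "K \<in> carrier_mat p q \<Longrightarrow> N \<in> carrier_mat q r \<Longrightarrow> eval_mat (K * N) \<mu> = eval_mat K \<mu> * eval_mat N \<mu>"
  unfolding eval_mat_def by (rule semiring_hom.mat_hom_mult[OF poly_hom.semiring_hom_axioms])

lemma eval_mat_kron_id: "eval_mat (kron K (1\<^sub>m n)) \<mu> = kron (eval_mat K \<mu>) (1\<^sub>m n)"
proof (rule eq_matI)
  fix i j assume "i < dim_row (kron (eval_mat K \<mu>) (1\<^sub>m n))" "j < dim_col (kron (eval_mat K \<mu>) (1\<^sub>m n))"
  then have ij: "i < dim_row K * n" "j < dim_col K * n"
    by (auto simp: kron_def eval_mat_def)
  then have "n > 0"
    by (cases n) auto
  then show "eval_mat (kron K (1\<^sub>m n)) \<mu> $$ (i, j) = kron (eval_mat K \<mu>) (1\<^sub>m n) $$ (i, j)"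
    using ij by (simp add: kron_def eval_mat_def less_mult_imp_div_less)
qed (auto simp: kron_def eval_mat_def)

lemma eval_pencil:
  "A \<in> carrier_mat p q \<Longrightarrow> B \<in> carrier_mat p q \<Longrightarrow> eval_mat (pencil A B) \<mu> = A - \<mu> \<cdot>\<^sub>m B"
  by (intro eq_matI) (auto simp: eval_mat_def pencil_def)

lemma L_mat_carrier: "L_mat k \<in> carrier_mat k (k + 1)"
  by (simp add: L_mat_def)

lemma Lambda_mat_carrier: "Lambda_mat k \<in> carrier_mat (k + 1) 1"
  by (simp add: Lambda_mat_def)

lemma L_kron_mult_vec:
  assumes v: "v \<in> carrier_vec ((k + 1) * n)" and i: "i < k" and r: "r < n"
  shows "(kron (eval_mat (L_mat k) \<mu>) (1\<^sub>m n) *\<^sub>v v) $ (i * n + r)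
    = \<mu> * v $ ((i + 1) * n + r) - v $ (i * n + r)"
proof -
  have "(kron (eval_mat (L_mat k) \<mu>) (1\<^sub>m n) *\<^sub>v v) $ (i * n + r)
      = (\<Sum>j<k+1. eval_mat (L_mat k) \<mu> $$ (i, j) * v $ (j * n + r))"
    by (rule kron_id_mult_vec[OF eval_mat_carrier[OF L_mat_carrier] v i r])
  also have "\<dots> = (\<Sum>j<k+1. (if j = i then - v $ (i * n + r) else 0)
      + (if j = i + 1 then \<mu> * v $ ((i + 1) * n + r) else 0))"
    using i by (intro sum.cong) (auto simp: eval_mat_def L_mat_def)
  also have "\<dots> = \<mu> * v $ ((i + 1) * n + r) - v $ (i * n + r)"
    using i by (simp add: sum.distrib)
  finally show ?thesis .
qed

lemma L_transpose_kron_mult_vec: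
  assumes v: "v \<in> carrier_vec (k * n)" and i: "i < k + 1" and r: "r < n"
  shows "(kron (eval_mat ((L_mat k)\<^sup>T) \<mu>) (1\<^sub>m n) *\<^sub>v v) $ (i * n + r)
    = (if 0 < i then \<mu> * v $ ((i - 1) * n + r) else 0) - (if i < k then v $ (i * n + r) else 0)"
proof -
  have LT: "(L_mat k)\<^sup>T \<in> carrier_mat (k + 1) k"
    using L_mat_carrier by simp
  have "(kron (eval_mat ((L_mat k)\<^sup>T) \<mu>) (1\<^sub>m n) *\<^sub>v v) $ (i * n + r)
      = (\<Sum>j<k. eval_mat ((L_mat k)\<^sup>T) \<mu> $$ (i, j) * v $ (j * n + r))"
    by (rule kron_id_mult_vec[OF eval_mat_carrier[OF LT] v i r])
  also have "\<dots> = (\<Sum>j<k. (if j = i - 1 then (if 0 < i then \<mu> * v $ ((i - 1) * n + r) else 0) else 0)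
      + (if j = i then - v $ (i * n + r) else 0))"
    using i by (intro sum.cong) (auto simp: eval_mat_def L_mat_def)
  also have "\<dots> = (if 0 < i then \<mu> * v $ ((i - 1) * n + r) else 0) - (if i < k then v $ (i * n + r) else 0)"
    using i by (auto simp add: sum.distrib)
  finally show ?thesis .
qed

lemma Lambda_kron_mult_vec:
  assumes v: "v \<in> carrier_vec n" and i: "i < k + 1" and r: "r < n"
  shows "(kron (eval_mat (Lambda_mat k) \<mu>) (1\<^sub>m n) *\<^sub>v v) $ (i * n + r) = \<mu> ^ (k - i) * v $ r"
  using kron_id_mult_vec[OF eval_mat_carrier[OF Lambda_mat_carrier], of v n i k r \<mu>] v i r
  by (simp add: eval_mat_def Lambda_mat_def poly_monom)

lemma Lambda_transpose_kron_mult_vec: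
  assumes v: "v \<in> carrier_vec ((k + 1) * n)" and r: "r < n"
  shows "(kron (eval_mat ((Lambda_mat k)\<^sup>T) \<mu>) (1\<^sub>m n) *\<^sub>v v) $ r
    = (\<Sum>j<k+1. \<mu> ^ (k - j) * v $ (j * n + r))"
proof -
  have "(Lambda_mat k)\<^sup>T \<in> carrier_mat 1 (k + 1)"
    using Lambda_mat_carrier by simp
  from kron_id_mult_vec[OF eval_mat_carrier[OF this] v, of 0 r \<mu>] r show ?thesis
    by (simp add: eval_mat_def Lambda_mat_def poly_monom)
qed

section \<open>Kernel of \<open>L\<^sub>k\<close> and range of its transpose\<close>

text \<open>The equations \<open>(L\<^sub>k(\<mu>) \<otimes> I) v = 0\<close> say that each block is \<open>\<mu>\<close> times the next one, so all blocks
  are determined by the last.\<close>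
lemma L_kron_kernel:
  assumes v: "v \<in> carrier_vec ((k + 1) * n)"
  shows "kron (eval_mat (L_mat k) \<mu>) (1\<^sub>m n) *\<^sub>v v = 0\<^sub>v (k * n)
    \<longleftrightarrow> v = kron (eval_mat (Lambda_mat k) \<mu>) (1\<^sub>m n) *\<^sub>v recovered_vec n k v"
    (is "?K *\<^sub>v v = _ \<longleftrightarrow> v = ?\<Lambda> *\<^sub>v ?y")
proof -
  have K: "?K \<in> carrier_mat (k * n) ((k + 1) * n)"
    by (intro kron_carrier eval_mat_carrier L_mat_carrier)
  have L: "?\<Lambda> \<in> carrier_mat ((k + 1) * n) n"
    using kron_carrier[OF eval_mat_carrier[OF Lambda_mat_carrier]] by (metis mult_1)
  have y: "?y \<in> carrier_vec n"
    by (simp add: recovered_vec_def)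
  have Kv: "(?K *\<^sub>v v) $ (i * n + r) = \<mu> * v $ ((i + 1) * n + r) - v $ (i * n + r)"
    if "i < k" "r < n" for i r
    using L_kron_mult_vec[OF v that] .
  have Ly: "(?\<Lambda> *\<^sub>v ?y) $ (i * n + r) = \<mu> ^ (k - i) * v $ (k * n + r)" if "i < k + 1" "r < n" for i r
    using Lambda_kron_mult_vec[OF y that] that by (simp add: recovered_vec_def)
  show ?thesis
  proof
    assume 0: "?K *\<^sub>v v = 0\<^sub>v (k * n)"
    have step: "v $ (i * n + r) = \<mu> * v $ ((i + 1) * n + r)" if "i < k" "r < n" for i r
      using Kv[OF that] block_index_less[OF that] by (simp add: 0)
    have pow: "v $ ((k - l) * n + r) = \<mu> ^ l * v $ (k * n + r)" if "l \<le> k" "r < n" for l r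
      using that(1)
    proof (induction l)
      case (Suc l)
      have "v $ ((k - Suc l) * n + r) = \<mu> * v $ ((k - Suc l + 1) * n + r)"
        using Suc.prems that(2) by (intro step) auto
      also have "k - Suc l + 1 = k - l"
        using Suc.prems by simp
      finally show ?case
        using Suc by simp
    qed simp
    show "v = ?\<Lambda> *\<^sub>v ?y"
    proof (rule eq_vec_blocksI[OF v])
      fix i r assume ir: "i < k + 1" "r < n"
      then show "v $ (i * n + r) = (?\<Lambda> *\<^sub>v ?y) $ (i * n + r)"
        using Ly[OF ir] pow[of "k - i" r] by simp
    qed (use L y in auto)
  next
    assume eq: "v = ?\<Lambda> *\<^sub>v ?y"
    have pow: "v $ (i * n + r) = \<mu> ^ (k - i) * v $ (k * n + r)" if "i < k + 1" "r < n" for i r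
      using Ly[OF that] eq by simp
    show "?K *\<^sub>v v = 0\<^sub>v (k * n)"
    proof (rule eq_vec_blocksI)
      fix i r assume ir: "i < k" "r < n"
      have "k - i = Suc (k - Suc i)"
        using ir by simp
      then have "\<mu> ^ (k - i) = \<mu> * \<mu> ^ (k - (i + 1))"
        by simp
      then show "(?K *\<^sub>v v) $ (i * n + r) = 0\<^sub>v (k * n) $ (i * n + r)"
        using Kv[OF ir] pow[of i r] pow[of "i + 1" r] ir block_index_less[OF ir] by simp
    qed (use K v in auto)
  qed
qed

text \<open>Row \<open>j\<close> of \<open>L\<^sub>k\<^sup>T w\<close> is \<open>\<mu> w\<^sub>j\<^sub>-\<^sub>1 - w\<^sub>j\<close>; weighting it with \<open>\<mu>\<^sup>k\<^sup>-\<^sup>j\<close> makes the sum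
  telescope. The boundary terms vanish because the first row has no \<open>w\<^sub>-\<^sub>1\<close> and the last no \<open>w\<^sub>k\<close>.\<close>
lemma Lambda_L_transpose:
  assumes w: "w \<in> carrier_vec (k * n)"
  shows "kron (eval_mat ((Lambda_mat k)\<^sup>T) \<mu>) (1\<^sub>m n)
    *\<^sub>v (kron (eval_mat ((L_mat k)\<^sup>T) \<mu>) (1\<^sub>m n) *\<^sub>v w) = 0\<^sub>v n" (is "?\<Lambda> *\<^sub>v (?K *\<^sub>v w) = _")
proof (rule eq_vecI)
  have K: "?K \<in> carrier_mat ((k + 1) * n) (k * n)"
    using L_mat_carrier by (intro kron_carrier eval_mat_carrier) simp
  have L: "?\<Lambda> \<in> carrier_mat n ((k + 1) * n)"
    using kron_carrier[OF eval_mat_carrier, of "(Lambda_mat k)\<^sup>T" 1 "k + 1" \<mu> n] Lambda_mat_carrier by simp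
  show "dim_vec (?\<Lambda> *\<^sub>v (?K *\<^sub>v w)) = dim_vec (0\<^sub>v n :: complex vec)"
    using L by simp
  fix r assume "r < dim_vec (0\<^sub>v n :: complex vec)"
  then have r: "r < n"
    by simp
  have "(?\<Lambda> *\<^sub>v (?K *\<^sub>v w)) $ r = (\<Sum>j<k+1. \<mu> ^ (k - j) * (?K *\<^sub>v w) $ (j * n + r))"
    using K w r by (intro Lambda_transpose_kron_mult_vec) auto
  also have "\<dots> = (\<Sum>j<Suc k. (if 0 < j then \<mu> ^ (k - (j - 1)) * w $ ((j - 1) * n + r) else 0)
      - (if j < k then \<mu> ^ (k - j) * w $ (j * n + r) else 0))"
  proof (rule sum.cong)
    fix j assume "j \<in> {..<Suc k}"
    then have j: "j < k + 1" by simp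
    have "\<mu> ^ (k - (j - 1)) = \<mu> ^ (k - j) * \<mu>" if "0 < j"
    proof -
      have "k - (j - 1) = Suc (k - j)"
        using that j by simp
      then show ?thesis by simp
    qed
    then show "\<mu> ^ (k - j) * (?K *\<^sub>v w) $ (j * n + r) =
        (if 0 < j then \<mu> ^ (k - (j - 1)) * w $ ((j - 1) * n + r) else 0)
        - (if j < k then \<mu> ^ (k - j) * w $ (j * n + r) else 0)"
      unfolding L_transpose_kron_mult_vec[OF w j r] by (simp add: right_diff_distrib)
  qed simp
  also have "\<dots> = (\<Sum>j<k. \<mu> ^ (k - j) * w $ (j * n + r)) - (\<Sum>j<k. \<mu> ^ (k - j) * w $ (j * n + r))"
    unfolding sum_subtractf by (subst sum.lessThan_Suc_shift) (simp add: sum.lessThan_Suc)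
  finally show "(?\<Lambda> *\<^sub>v (?K *\<^sub>v w)) $ r = 0\<^sub>v n $ r"
    using r by simp
qed

text \<open>Together with \<open>Lambda_L_transpose\<close> this says that the range of \<open>L\<^sub>k\<^sup>T \<otimes> I\<close> is the kernel of
  \<open>\<Lambda>\<^sub>k\<^sup>T \<otimes> I\<close>. The first \<open>k\<close> block rows determine \<open>w\<close> recursively, as the negated Horner partial
  sums of \<open>\<Sum>\<^sub>j \<mu>\<^sup>k\<^sup>-\<^sup>j u\<^sub>j\<close>; the last block row then holds because the complete sum is zero.\<close>
lemma L_transpose_range:
  assumes u: "u \<in> carrier_vec ((k + 1) * n)"
    and 0: "kron (eval_mat ((Lambda_mat k)\<^sup>T) \<mu>) (1\<^sub>m n) *\<^sub>v u = 0\<^sub>v n"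
  obtains w where "w \<in> carrier_vec (k * n)" "kron (eval_mat ((L_mat k)\<^sup>T) \<mu>) (1\<^sub>m n) *\<^sub>v w = u"
proof -
  let ?K = "kron (eval_mat ((L_mat k)\<^sup>T) \<mu>) (1\<^sub>m n)"
  have K: "?K \<in> carrier_mat ((k + 1) * n) (k * n)"
    using L_mat_carrier by (intro kron_carrier eval_mat_carrier) simp
  define h where "h i r = (\<Sum>j<i. \<mu> ^ (i - 1 - j) * u $ (j * n + r))" for i r
  have h_Suc: "h (Suc i) r = \<mu> * h i r + u $ (i * n + r)" for i r
  proof -
    have "(\<Sum>j<i. \<mu> ^ (i - j) * u $ (j * n + r)) = \<mu> * h i r"
      unfolding h_def sum_distrib_left
    proof (rule sum.cong)
      fix j assume "j \<in> {..<i}"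
      then have "i - j = Suc (i - 1 - j)" by auto
      then show "\<mu> ^ (i - j) * u $ (j * n + r) = \<mu> * (\<mu> ^ (i - 1 - j) * u $ (j * n + r))"
        by simp
    qed simp
    then show ?thesis
      by (simp add: h_def)
  qed
  \<comment> \<open>The complete Horner sum vanishes by assumption.\<close>
  have h_top: "h (Suc k) r = 0" if "r < n" for r
    using Lambda_transpose_kron_mult_vec[OF u that, of \<mu>] that by (simp add: 0 h_def)
  define w where "w = vec (k * n) (\<lambda>l. - h (Suc (l div n)) (l mod n))"
  have w: "w \<in> carrier_vec (k * n)"
    by (simp add: w_def)
  have w_idx: "w $ (i * n + r) = - h (Suc i) r" if "i < k" "r < n" for i r
    using that block_index_less[OF that] by (simp add: w_def)
  have "?K *\<^sub>v w = u"
  proof (rule eq_vec_blocksI[OF _ u])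
    fix i r assume ir: "i < k + 1" "r < n"
    have 1: "(if 0 < i then \<mu> * w $ ((i - 1) * n + r) else 0) = - \<mu> * h i r"
    proof (cases i)
      case (Suc l)
      then show ?thesis
        using w_idx[of l r] ir by simp
    qed (simp add: h_def)
    have 2: "(if i < k then w $ (i * n + r) else 0) = - h (Suc i) r"
      using w_idx[of i r] ir h_top[of r] by (auto simp: less_Suc_eq)
    show "(?K *\<^sub>v w) $ (i * n + r) = u $ (i * n + r)"
      unfolding L_transpose_kron_mult_vec[OF w ir] 1 2 by (simp add: h_Suc)
  qed (use K w in auto)
  with w show ?thesis
    using that by blast
qed

section \<open>Block Kronecker linearizations at a point\<close>

text \<open>Evaluation at \<open>\<mu>\<close> turns the polynomial identities into complex ones. The factorization of \<open>P(\<mu>)\<close>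
  is stated on vectors, the form in which it meets the kernel and range lemmas.\<close>
lemma block_kronecker_at:
  assumes lin: "is_block_kronecker_linearization n \<epsilon> \<eta> P (pencil A B)"
    and A: "A \<in> carrier_mat N N" and B: "B \<in> carrier_mat N N"
  obtains M where "M \<in> carrier_mat ((\<eta> + 1) * n) ((\<epsilon> + 1) * n)"
    "A - \<mu> \<cdot>\<^sub>m B = four_block_mat M (kron (eval_mat ((L_mat \<eta>)\<^sup>T) \<mu>) (1\<^sub>m n))
       (kron (eval_mat (L_mat \<epsilon>) \<mu>) (1\<^sub>m n)) (0\<^sub>m (\<epsilon> * n) (\<eta> * n))"
    "\<And>v. v \<in> carrier_vec n \<Longrightarrow> eval_mat P \<mu> *\<^sub>v v = kron (eval_mat ((Lambda_mat \<eta>)\<^sup>T) \<mu>) (1\<^sub>m n) *\<^sub>v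
       (M *\<^sub>v (kron (eval_mat (Lambda_mat \<epsilon>) \<mu>) (1\<^sub>m n) *\<^sub>v v))"
proof -
  from lin obtain M where M: "M \<in> carrier_mat ((\<eta> + 1) * n) ((\<epsilon> + 1) * n)"
    and P: "kron ((Lambda_mat \<eta>)\<^sup>T) (1\<^sub>m n) * M * kron (Lambda_mat \<epsilon>) (1\<^sub>m n) = P"
    and L: "pencil A B = four_block_mat M (kron ((L_mat \<eta>)\<^sup>T) (1\<^sub>m n))
                (kron (L_mat \<epsilon>) (1\<^sub>m n)) (0\<^sub>m (\<epsilon> * n) (\<eta> * n))"
    unfolding is_block_kronecker_linearization_def by blast
  have c1: "kron ((L_mat \<eta>)\<^sup>T) (1\<^sub>m n) \<in> carrier_mat ((\<eta> + 1) * n) (\<eta> * n)"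
    using L_mat_carrier by (intro kron_carrier) simp
  have c2: "kron (L_mat \<epsilon>) (1\<^sub>m n) \<in> carrier_mat (\<epsilon> * n) ((\<epsilon> + 1) * n)"
    using L_mat_carrier by (intro kron_carrier)
  have c3: "kron ((Lambda_mat \<eta>)\<^sup>T) (1\<^sub>m n) \<in> carrier_mat n ((\<eta> + 1) * n)"
    using kron_carrier[of "(Lambda_mat \<eta>)\<^sup>T" 1 "\<eta> + 1" n] Lambda_mat_carrier by simp
  have c4: "kron (Lambda_mat \<epsilon>) (1\<^sub>m n) \<in> carrier_mat ((\<epsilon> + 1) * n) n"
    using kron_carrier[OF Lambda_mat_carrier, of \<epsilon> n] by simp
  show ?thesis
  proof
    show M': "eval_mat M \<mu> \<in> carrier_mat ((\<eta> + 1) * n) ((\<epsilon> + 1) * n)"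
      using M by (rule eval_mat_carrier)
    have "A - \<mu> \<cdot>\<^sub>m B = eval_mat (pencil A B) \<mu>"
      using eval_pencil[OF A B] by simp
    also have "\<dots> = four_block_mat (eval_mat M \<mu>) (eval_mat (kron ((L_mat \<eta>)\<^sup>T) (1\<^sub>m n)) \<mu>)
       (eval_mat (kron (L_mat \<epsilon>) (1\<^sub>m n)) \<mu>) (eval_mat (0\<^sub>m (\<epsilon> * n) (\<eta> * n)) \<mu>)"
      unfolding L eval_mat_def by (rule map_four_block_mat[OF M c1 c2]) simp
    also have "eval_mat (0\<^sub>m (\<epsilon> * n) (\<eta> * n)) \<mu> = 0\<^sub>m (\<epsilon> * n) (\<eta> * n)"
      by (intro eq_matI) (auto simp: eval_mat_def)
    finally show "A - \<mu> \<cdot>\<^sub>m B = four_block_mat (eval_mat M \<mu>) (kron (eval_mat ((L_mat \<eta>)\<^sup>T) \<mu>) (1\<^sub>m n))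
       (kron (eval_mat (L_mat \<epsilon>) \<mu>) (1\<^sub>m n)) (0\<^sub>m (\<epsilon> * n) (\<eta> * n))"
      by (simp only: eval_mat_kron_id)
    fix v :: "complex vec" assume v: "v \<in> carrier_vec n"
    have "eval_mat P \<mu> = eval_mat (kron ((Lambda_mat \<eta>)\<^sup>T) (1\<^sub>m n)) \<mu> * eval_mat M \<mu>
        * eval_mat (kron (Lambda_mat \<epsilon>) (1\<^sub>m n)) \<mu>"
      unfolding P[symmetric] eval_mat_mult[OF mult_carrier_mat[OF c3 M] c4] eval_mat_mult[OF c3 M] ..
    then show "eval_mat P \<mu> *\<^sub>v v = kron (eval_mat ((Lambda_mat \<eta>)\<^sup>T) \<mu>) (1\<^sub>m n) *\<^sub>v
       (eval_mat M \<mu> *\<^sub>v (kron (eval_mat (Lambda_mat \<epsilon>) \<mu>) (1\<^sub>m n) *\<^sub>v v))"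
      unfolding eval_mat_kron_id[symmetric]
      using eval_mat_carrier[OF c3, of \<mu>] M' eval_mat_carrier[OF c4, of \<mu>] v
      by (simp add: assoc_mult_mat_vec[of _ n "(\<eta> + 1) * n" _ n] assoc_mult_mat_vec[of _ n "(\<eta> + 1) * n"]
          assoc_mult_mat_vec[of _ "(\<eta> + 1) * n" "(\<epsilon> + 1) * n" _ n] assoc_mult_mat[of _ n "(\<eta> + 1) * n" _ "(\<epsilon> + 1) * n" _ n])
  qed
qed

lemma recovered_vec_append:
  assumes "v \<in> carrier_vec (m * n)" "i < m"
  shows "recovered_vec n i (v @\<^sub>v w) = recovered_vec n i v"
  using assms block_index_less[of i m _ n]
  by (intro eq_vecI) (auto simp: recovered_vec_def trans_less_add1)

lemma recovered_vec_Lambda_kron: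
  assumes y: "y \<in> carrier_vec n" and i: "i < k + 1"
  shows "recovered_vec n i (kron (eval_mat (Lambda_mat k) \<mu>) (1\<^sub>m n) *\<^sub>v y) = \<mu> ^ (k - i) \<cdot>\<^sub>v y"
  using Lambda_kron_mult_vec[OF y i] y by (intro eq_vecI) (auto simp: recovered_vec_def)

text \<open>Split \<open>z\<close> as \<open>(z\<^sub>1, z\<^sub>2)\<close>. The lower block row of \<open>L(\<mu>) z = 0\<close> gives \<open>z\<^sub>1 = \<Lambda>\<^sub>\<epsilon>(\<mu>) \<otimes> y\<close>. The
  upper one gives \<open>M z\<^sub>1 = - (L\<^sub>\<eta>\<^sup>T \<otimes> I) z\<^sub>2\<close>, which \<open>\<Lambda>\<^sub>\<eta>\<^sup>T \<otimes> I\<close> sends to zero; but it sends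
  \<open>M z\<^sub>1\<close> to \<open>P(\<mu>) y\<close>.\<close>
lemma block_kronecker_null_vector:
  assumes lin: "is_block_kronecker_linearization n \<epsilon> \<eta> P (pencil A B)"
    and A: "A \<in> carrier_mat ((\<epsilon> + \<eta> + 1) * n) ((\<epsilon> + \<eta> + 1) * n)"
    and B: "B \<in> carrier_mat ((\<epsilon> + \<eta> + 1) * n) ((\<epsilon> + \<eta> + 1) * n)"
    and z: "z \<in> carrier_vec ((\<epsilon> + \<eta> + 1) * n)"
    and 0: "(A - \<mu> \<cdot>\<^sub>m B) *\<^sub>v z = 0\<^sub>v ((\<epsilon> + \<eta> + 1) * n)"
  shows "eval_mat P \<mu> *\<^sub>v recovered_vec n \<epsilon> z = 0\<^sub>v n"
    and "\<And>i. i < \<epsilon> + 1 \<Longrightarrow> recovered_vec n i z = \<mu> ^ (\<epsilon> - i) \<cdot>\<^sub>v recovered_vec n \<epsilon> z"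
proof -
  obtain M where M: "M \<in> carrier_mat ((\<eta> + 1) * n) ((\<epsilon> + 1) * n)"
    and F: "A - \<mu> \<cdot>\<^sub>m B = four_block_mat M (kron (eval_mat ((L_mat \<eta>)\<^sup>T) \<mu>) (1\<^sub>m n))
       (kron (eval_mat (L_mat \<epsilon>) \<mu>) (1\<^sub>m n)) (0\<^sub>m (\<epsilon> * n) (\<eta> * n))"
    and P: "\<And>v. v \<in> carrier_vec n \<Longrightarrow> eval_mat P \<mu> *\<^sub>v v = kron (eval_mat ((Lambda_mat \<eta>)\<^sup>T) \<mu>) (1\<^sub>m n) *\<^sub>v
       (M *\<^sub>v (kron (eval_mat (Lambda_mat \<epsilon>) \<mu>) (1\<^sub>m n) *\<^sub>v v))"
    using block_kronecker_at[OF lin A B] by blast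
  let ?K = "kron (eval_mat ((L_mat \<eta>)\<^sup>T) \<mu>) (1\<^sub>m n)"
  let ?J = "kron (eval_mat (L_mat \<epsilon>) \<mu>) (1\<^sub>m n)"
  have K: "?K \<in> carrier_mat ((\<eta> + 1) * n) (\<eta> * n)"
    using L_mat_carrier by (intro kron_carrier eval_mat_carrier) simp
  have J: "?J \<in> carrier_mat (\<epsilon> * n) ((\<epsilon> + 1) * n)"
    using L_mat_carrier by (intro kron_carrier eval_mat_carrier)
  define z1 where "z1 = vec_first z ((\<epsilon> + 1) * n)"
  define z2 where "z2 = vec_last z (\<eta> * n)"
  have dims: "(\<epsilon> + \<eta> + 1) * n = (\<epsilon> + 1) * n + \<eta> * n" "(\<epsilon> + \<eta> + 1) * n = (\<eta> + 1) * n + \<epsilon> * n"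
    by (simp_all add: algebra_simps)
  have z1: "z1 \<in> carrier_vec ((\<epsilon> + 1) * n)" and z2: "z2 \<in> carrier_vec (\<eta> * n)"
    by (auto simp: z1_def z2_def)
  have zz: "z = z1 @\<^sub>v z2"
    using vec_first_last_append[OF z[unfolded dims(1)]] by (simp only: z1_def z2_def)
  have eq: "(M *\<^sub>v z1 + ?K *\<^sub>v z2) @\<^sub>v (?J *\<^sub>v z1 + 0\<^sub>m (\<epsilon> * n) (\<eta> * n) *\<^sub>v z2)
      = 0\<^sub>v ((\<eta> + 1) * n) @\<^sub>v 0\<^sub>v (\<epsilon> * n)"
  proof -
    have "(0\<^sub>v ((\<eta> + 1) * n) :: complex vec) @\<^sub>v 0\<^sub>v (\<epsilon> * n) = 0\<^sub>v ((\<epsilon> + \<eta> + 1) * n)"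
      unfolding dims(2) by (intro eq_vecI) auto
    then show ?thesis
      using 0 four_block_mat_mult_vec[OF M K J zero_carrier_mat z1 z2] by (simp add: F zz)
  qed
  have eqs: "M *\<^sub>v z1 + ?K *\<^sub>v z2 = 0\<^sub>v ((\<eta> + 1) * n)" "?J *\<^sub>v z1 = 0\<^sub>v (\<epsilon> * n)"
  proof -
    have M1: "M *\<^sub>v z1 + ?K *\<^sub>v z2 \<in> carrier_vec ((\<eta> + 1) * n)" and J1: "?J *\<^sub>v z1 \<in> carrier_vec (\<epsilon> * n)"
      by (intro add_carrier_vec mult_mat_vec_carrier[OF M z1] mult_mat_vec_carrier[OF K z2]
          mult_mat_vec_carrier[OF J z1])+
    have "0\<^sub>m (\<epsilon> * n) (\<eta> * n) *\<^sub>v z2 = 0\<^sub>v (\<epsilon> * n)"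
      using z2 by (intro eq_vecI) auto
    then show "M *\<^sub>v z1 + ?K *\<^sub>v z2 = 0\<^sub>v ((\<eta> + 1) * n)" "?J *\<^sub>v z1 = 0\<^sub>v (\<epsilon> * n)"
      using eq append_vec_eq[OF M1 zero_carrier_vec] right_zero_vec[OF J1] by simp_all
  qed
  define y where "y = recovered_vec n \<epsilon> z"
  have y: "y \<in> carrier_vec n"
    by (simp add: y_def recovered_vec_def)
  have y': "recovered_vec n \<epsilon> z1 = y"
    using recovered_vec_append[OF z1, of \<epsilon> z2] by (simp add: y_def zz)
  have z1_eq: "z1 = kron (eval_mat (Lambda_mat \<epsilon>) \<mu>) (1\<^sub>m n) *\<^sub>v y"
    using L_kron_kernel[OF z1, of \<mu>] eqs(2) by (simp add: y')
  show "recovered_vec n i z = \<mu> ^ (\<epsilon> - i) \<cdot>\<^sub>v recovered_vec n \<epsilon> z" if "i < \<epsilon> + 1" for i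
    using recovered_vec_append[OF z1 that, of z2] recovered_vec_Lambda_kron[OF y that, of \<mu>]
    by (simp add: zz[symmetric] y_def[symmetric] z1_eq[symmetric])
  have "M *\<^sub>v z1 = ?K *\<^sub>v (- z2)"
  proof (rule eq_vecI)
    fix i assume "i < dim_vec (?K *\<^sub>v (- z2))"
    then have i: "i < (\<eta> + 1) * n"
      using K by simp
    have "(M *\<^sub>v z1 + ?K *\<^sub>v z2) $ i = 0"
      using eqs(1) i by simp
    then have "(M *\<^sub>v z1) $ i + (?K *\<^sub>v z2) $ i = 0"
      using K i by (simp del: index_mult_mat_vec)
    moreover have "(?K *\<^sub>v (- z2)) $ i = - (?K *\<^sub>v z2) $ i"
      using K z2 i by simp
    ultimately show "(M *\<^sub>v z1) $ i = (?K *\<^sub>v (- z2)) $ i"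
      by (metis add.left_inverse add_right_cancel)
  qed (use M K in auto)
  then show "eval_mat P \<mu> *\<^sub>v recovered_vec n \<epsilon> z = 0\<^sub>v n"
    using P[OF y] Lambda_L_transpose[of "- z2" \<eta> n \<mu>] z2
    by (simp add: z1_eq[symmetric] y_def[symmetric])
qed

text \<open>The vector is \<open>v = (\<Lambda>\<^sub>\<epsilon>(\<mu>) \<otimes> u, w)\<close>, whose residual has lower part zero and upper part
  \<open>M (\<Lambda>\<^sub>\<epsilon> \<otimes> u) + (L\<^sub>\<eta>\<^sup>T \<otimes> I) w\<close>. By \<open>L_transpose_range\<close> the choice of \<open>w\<close> turns the upper part into any
  vector \<open>g\<close> with \<open>(\<Lambda>\<^sub>\<eta>\<^sup>T \<otimes> I) g = P(\<mu>) u\<close>. The vector \<open>g\<close> that carries \<open>s P(\<mu>) u\<close> in block \<open>j\<close> and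
  nothing elsewhere is of this kind, since \<open>\<Lambda>\<^sub>\<eta>\<close> has the entry \<open>\<mu>\<^sup>\<eta>\<^sup>-\<^sup>j\<close> there. The index \<open>j\<close> is left free
  because its best value depends on whether \<open>|\<mu>| \<le> 1\<close>.\<close>
lemma block_kronecker_lift:
  assumes lin: "is_block_kronecker_linearization n \<epsilon> \<eta> P (pencil A B)"
    and A: "A \<in> carrier_mat ((\<epsilon> + \<eta> + 1) * n) ((\<epsilon> + \<eta> + 1) * n)"
    and B: "B \<in> carrier_mat ((\<epsilon> + \<eta> + 1) * n) ((\<epsilon> + \<eta> + 1) * n)"
    and u: "u \<in> carrier_vec n"
    and j: "j < \<eta> + 1" and s: "s * \<mu> ^ (\<eta> - j) = 1"
  obtains v where "v \<in> carrier_vec ((\<epsilon> + \<eta> + 1) * n)"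
    "\<And>i. i < \<epsilon> + 1 \<Longrightarrow> recovered_vec n i v = \<mu> ^ (\<epsilon> - i) \<cdot>\<^sub>v u"
    "norm2 ((A - \<mu> \<cdot>\<^sub>m B) *\<^sub>v v) = cmod s * norm2 (eval_mat P \<mu> *\<^sub>v u)"
proof -
  obtain M where M: "M \<in> carrier_mat ((\<eta> + 1) * n) ((\<epsilon> + 1) * n)"
    and F: "A - \<mu> \<cdot>\<^sub>m B = four_block_mat M (kron (eval_mat ((L_mat \<eta>)\<^sup>T) \<mu>) (1\<^sub>m n))
       (kron (eval_mat (L_mat \<epsilon>) \<mu>) (1\<^sub>m n)) (0\<^sub>m (\<epsilon> * n) (\<eta> * n))"
    and P: "\<And>v. v \<in> carrier_vec n \<Longrightarrow> eval_mat P \<mu> *\<^sub>v v = kron (eval_mat ((Lambda_mat \<eta>)\<^sup>T) \<mu>) (1\<^sub>m n) *\<^sub>v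
       (M *\<^sub>v (kron (eval_mat (Lambda_mat \<epsilon>) \<mu>) (1\<^sub>m n) *\<^sub>v v))"
    using block_kronecker_at[OF lin A B] by blast
  let ?K = "kron (eval_mat ((L_mat \<eta>)\<^sup>T) \<mu>) (1\<^sub>m n)"
  let ?J = "kron (eval_mat (L_mat \<epsilon>) \<mu>) (1\<^sub>m n)"
  let ?\<Lambda> = "kron (eval_mat ((Lambda_mat \<eta>)\<^sup>T) \<mu>) (1\<^sub>m n)"
  have K: "?K \<in> carrier_mat ((\<eta> + 1) * n) (\<eta> * n)"
    using L_mat_carrier by (intro kron_carrier eval_mat_carrier) simp
  have J: "?J \<in> carrier_mat (\<epsilon> * n) ((\<epsilon> + 1) * n)"
    using L_mat_carrier by (intro kron_carrier eval_mat_carrier)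
  have \<Lambda>: "?\<Lambda> \<in> carrier_mat n ((\<eta> + 1) * n)"
    using kron_carrier[OF eval_mat_carrier, of "(Lambda_mat \<eta>)\<^sup>T" 1 "\<eta> + 1" \<mu> n] Lambda_mat_carrier by simp
  have \<Lambda>\<epsilon>: "kron (eval_mat (Lambda_mat \<epsilon>) \<mu>) (1\<^sub>m n) \<in> carrier_mat ((\<epsilon> + 1) * n) n"
    using kron_carrier[OF eval_mat_carrier[OF Lambda_mat_carrier], of \<epsilon> \<mu> n] by simp
  define v1 where "v1 = kron (eval_mat (Lambda_mat \<epsilon>) \<mu>) (1\<^sub>m n) *\<^sub>v u"
  have v1: "v1 \<in> carrier_vec ((\<epsilon> + 1) * n)"
    using \<Lambda>\<epsilon> u by (auto simp: v1_def)
  define p where "p = eval_mat P \<mu> *\<^sub>v u"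
  have p_eq: "p = ?\<Lambda> *\<^sub>v (M *\<^sub>v v1)"
    unfolding p_def v1_def using P[OF u] .
  have p: "p \<in> carrier_vec n"
    unfolding p_eq by (rule mult_mat_vec_carrier[OF \<Lambda> mult_mat_vec_carrier[OF M v1]])
  define g where "g = vec ((\<eta> + 1) * n) (\<lambda>l. if l div n = j then s * p $ (l mod n) else 0)"
  have g: "g \<in> carrier_vec ((\<eta> + 1) * n)"
    by (simp add: g_def)
  have g_idx: "g $ (i * n + r) = (if i = j then s * p $ r else 0)" if "i < \<eta> + 1" "r < n" for i r
    using that block_index_less[OF that] by (simp add: g_def)
  have g_proj: "?\<Lambda> *\<^sub>v g = p"
  proof (rule eq_vecI)
    fix r assume "r < dim_vec p"
    then have r: "r < n"
      using p by simp
    have "(?\<Lambda> *\<^sub>v g) $ r = (\<Sum>i<\<eta>+1. if i = j then \<mu> ^ (\<eta> - j) * (s * p $ r) else 0)"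
      unfolding Lambda_transpose_kron_mult_vec[OF g r]
      by (intro sum.cong) (use g_idx r in auto)
    also have "\<dots> = s * \<mu> ^ (\<eta> - j) * p $ r"
      using j by simp
    finally show "(?\<Lambda> *\<^sub>v g) $ r = p $ r"
      by (simp add: s)
  qed (use \<Lambda> p in auto)
  have "?\<Lambda> *\<^sub>v (g - M *\<^sub>v v1) = ?\<Lambda> *\<^sub>v g - ?\<Lambda> *\<^sub>v (M *\<^sub>v v1)"
    by (rule mult_minus_distrib_mat_vec[OF \<Lambda> g mult_mat_vec_carrier[OF M v1]])
  also have "\<dots> = 0\<^sub>v n"
    using p by (simp add: g_proj flip: p_eq)
  finally obtain w where w: "w \<in> carrier_vec (\<eta> * n)" and Kw: "?K *\<^sub>v w = g - M *\<^sub>v v1"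
    using L_transpose_range[OF minus_carrier_vec[OF g mult_mat_vec_carrier[OF M v1]]] by blast
  have Jv1: "?J *\<^sub>v v1 = 0\<^sub>v (\<epsilon> * n)"
  proof -
    have "recovered_vec n \<epsilon> v1 = u"
      using recovered_vec_Lambda_kron[OF u, of \<epsilon> \<epsilon> \<mu>] by (simp add: v1_def)
    then show ?thesis
      using L_kron_kernel[OF v1, of \<mu>] by (simp add: v1_def)
  qed
  have "(A - \<mu> \<cdot>\<^sub>m B) *\<^sub>v (v1 @\<^sub>v w)
      = (M *\<^sub>v v1 + ?K *\<^sub>v w) @\<^sub>v (?J *\<^sub>v v1 + 0\<^sub>m (\<epsilon> * n) (\<eta> * n) *\<^sub>v w)"
    unfolding F by (rule four_block_mat_mult_vec[OF M K J zero_carrier_mat v1 w])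
  also have "M *\<^sub>v v1 + ?K *\<^sub>v w = g"
    using g M unfolding Kw by (intro eq_vecI) auto
  also have "?J *\<^sub>v v1 + 0\<^sub>m (\<epsilon> * n) (\<eta> * n) *\<^sub>v w = 0\<^sub>v (\<epsilon> * n)"
    using w by (auto simp: Jv1)
  finally have res: "(A - \<mu> \<cdot>\<^sub>m B) *\<^sub>v (v1 @\<^sub>v w) = g @\<^sub>v 0\<^sub>v (\<epsilon> * n)" .
  have "(norm2 g)\<^sup>2 = (\<Sum>i<\<eta>+1. \<Sum>r<n. (cmod (g $ (i * n + r)))\<^sup>2)"
    using g by (simp only: norm2_sq carrier_vecD sum_blocks)
  also have "\<dots> = (\<Sum>i<\<eta>+1. if i = j then \<Sum>r<n. (cmod s * cmod (p $ r))\<^sup>2 else 0)"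
    by (intro sum.cong refl) (auto simp: g_idx norm_mult intro!: sum.cong)
  also have "\<dots> = (cmod s * norm2 p)\<^sup>2"
    using j p by (simp add: norm2_sq power_mult_distrib sum_distrib_left)
  finally have "norm2 g = cmod s * norm2 p"
    by (simp add: norm2_nonneg)
  moreover have "norm2 (g @\<^sub>v 0\<^sub>v (\<epsilon> * n)) = norm2 g"
    using norm2_append[of g "0\<^sub>v (\<epsilon> * n)"] by (simp add: norm2_zero norm2_nonneg)
  ultimately have nrm: "norm2 ((A - \<mu> \<cdot>\<^sub>m B) *\<^sub>v (v1 @\<^sub>v w)) = cmod s * norm2 (eval_mat P \<mu> *\<^sub>v u)"
    by (simp add: res p_def)
  show ?thesis
  proof
    show "v1 @\<^sub>v w \<in> carrier_vec ((\<epsilon> + \<eta> + 1) * n)"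
      using append_carrier_vec[OF v1 w] by (simp add: algebra_simps)
    show "recovered_vec n i (v1 @\<^sub>v w) = \<mu> ^ (\<epsilon> - i) \<cdot>\<^sub>v u" if "i < \<epsilon> + 1" for i
      using recovered_vec_append[OF v1 that, of w] recovered_vec_Lambda_kron[OF u that, of \<mu>]
      by (simp add: v1_def)
  qed (rule nrm)
qed

section \<open>The generalized Schur form\<close>

text \<open>Block triangularity of \<open>Q\<^sup>* (A - \<mu> B) Z\<close>, applied to a vector: the tail of the image depends on the
  tail \<open>w\<^sub>2\<close> alone. The whole first row is collected in \<open>e\<close>, which is either dropped from a norm or
  taken at \<open>w\<^sub>2 = 0\<close>, where only its diagonal entry survives.\<close>
lemma schur_deflation:
  assumes schur: "is_generalized_schur_form N A B Q Z \<alpha> \<beta> a b A1 B1" and N: "N > 0"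
    and A: "A \<in> carrier_mat N N" and B: "B \<in> carrier_mat N N"
    and w1: "w1 \<in> carrier_vec 1" and w2: "w2 \<in> carrier_vec (N - 1)"
  obtains e where "e \<in> carrier_vec 1"
    "mat_adjoint Q *\<^sub>v ((A - \<mu> \<cdot>\<^sub>m B) *\<^sub>v (Z *\<^sub>v (w1 @\<^sub>v w2))) = e @\<^sub>v (A1 - \<mu> \<cdot>\<^sub>m B1) *\<^sub>v w2"
    "w2 = 0\<^sub>v (N - 1) \<Longrightarrow> e = (\<beta> - \<mu> * \<alpha>) \<cdot>\<^sub>v w1"
proof -
  let ?S = "four_block_mat (mat 1 1 (\<lambda>_. \<beta> - \<mu> * \<alpha>)) (mat 1 (N - 1) (\<lambda>(_, j). cnj (a $ j) - \<mu> * cnj (b $ j)))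
     (0\<^sub>m (N - 1) 1) (A1 - \<mu> \<cdot>\<^sub>m B1)"
  from schur have Z: "Z \<in> carrier_mat N N" and Q: "mat_adjoint Q \<in> carrier_mat N N"
    and a: "a \<in> carrier_vec (N - 1)" and b: "b \<in> carrier_vec (N - 1)"
    and A1: "A1 \<in> carrier_mat (N - 1) (N - 1)" and B1: "B1 \<in> carrier_mat (N - 1) (N - 1)"
    and QB: "mat_adjoint Q * B * Z = bordered_mat \<alpha> b B1"
    and QA: "mat_adjoint Q * A * Z = bordered_mat \<beta> a A1"
    by (auto simp: is_generalized_schur_form_def unitary_mat_def intro: mat_adjoint_carrier)
  let ?w = "w1 @\<^sub>v w2"
  have w: "?w \<in> carrier_vec N"
    using append_carrier_vec[OF w1 w2] N by simp
  have F: "A - \<mu> \<cdot>\<^sub>m B \<in> carrier_mat N N"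
    using A B by auto
  have "mat_adjoint Q *\<^sub>v ((A - \<mu> \<cdot>\<^sub>m B) *\<^sub>v (Z *\<^sub>v ?w)) = mat_adjoint Q * (A - \<mu> \<cdot>\<^sub>m B) * Z *\<^sub>v ?w"
    using assoc_mult_mat_vec[OF mult_carrier_mat[OF Q F] Z w] assoc_mult_mat_vec[OF Q F, of "Z *\<^sub>v ?w"] Z w
    by simp
  also have "mat_adjoint Q * (A - \<mu> \<cdot>\<^sub>m B) * Z
      = mat_adjoint Q * A * Z - \<mu> \<cdot>\<^sub>m (mat_adjoint Q * B * Z)"
    using Q A B Z by (simp add: mult_minus_distrib_mat[of _ N N _ N] minus_mult_distrib_mat[of _ N N _ _ N]
        mult_smult_distrib[of _ N N _ N] mult_smult_assoc_mat[of _ N N _ N])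
  also have "\<dots> = ?S"
    unfolding QA QB using a b A1 B1 N by (intro eq_matI) (auto simp: bordered_mat_def)
  also have "?S *\<^sub>v ?w = (mat 1 1 (\<lambda>_. \<beta> - \<mu> * \<alpha>) *\<^sub>v w1
      + mat 1 (N - 1) (\<lambda>(_, j). cnj (a $ j) - \<mu> * cnj (b $ j)) *\<^sub>v w2)
      @\<^sub>v (0\<^sub>m (N - 1) 1 *\<^sub>v w1 + (A1 - \<mu> \<cdot>\<^sub>m B1) *\<^sub>v w2)" (is "_ = ?e @\<^sub>v _")
    using A1 B1 w1 w2 by (intro four_block_mat_mult_vec) auto
  also have "0\<^sub>m (N - 1) 1 *\<^sub>v w1 + (A1 - \<mu> \<cdot>\<^sub>m B1) *\<^sub>v w2 = (A1 - \<mu> \<cdot>\<^sub>m B1) *\<^sub>v w2"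
    using A1 B1 w1 by (intro eq_vecI) auto
  finally have eq: "mat_adjoint Q *\<^sub>v ((A - \<mu> \<cdot>\<^sub>m B) *\<^sub>v (Z *\<^sub>v ?w)) = ?e @\<^sub>v (A1 - \<mu> \<cdot>\<^sub>m B1) *\<^sub>v w2" .
  show ?thesis
  proof
    show "?e = (\<beta> - \<mu> * \<alpha>) \<cdot>\<^sub>v w1" if "w2 = 0\<^sub>v (N - 1)"
      using w1 that by (intro eq_vecI) (auto simp: scalar_prod_def)
    show "?e \<in> carrier_vec 1"
      by (intro carrier_vecI) simp
  qed (rule eq)
qed

lemma mat_mult_unit_vec:
  fixes A :: "complex mat"
  assumes "A \<in> carrier_mat p q" "j < q"
  shows "A *\<^sub>v unit_vec q j = col A j"
  using assms by (intro eq_vecI) auto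

text \<open>The first column of \<open>Q\<^sup>* (A - \<mu> B) Z\<close> is \<open>\<beta> - \<mu> \<alpha>\<close> followed by zeros, hence zero at \<open>\<mu> = \<beta> / \<alpha>\<close>.\<close>
lemma schur_null_vector:
  assumes schur: "is_generalized_schur_form N A B Q Z \<alpha> \<beta> a b A1 B1" and N: "N > 0"
    and A: "A \<in> carrier_mat N N" and B: "B \<in> carrier_mat N N" and \<alpha>: "\<alpha> \<noteq> 0"
  shows "(A - (\<beta> / \<alpha>) \<cdot>\<^sub>m B) *\<^sub>v col Z 0 = 0\<^sub>v N"
proof -
  let ?F = "A - (\<beta> / \<alpha>) \<cdot>\<^sub>m B" and ?e = "unit_vec 1 0 @\<^sub>v 0\<^sub>v (N - 1) :: complex vec"
  from schur have Z: "Z \<in> carrier_mat N N" and Q: "Q \<in> carrier_mat N N"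
    and A1: "A1 - (\<beta> / \<alpha>) \<cdot>\<^sub>m B1 \<in> carrier_mat (N - 1) (N - 1)"
    and QQ: "Q * mat_adjoint Q = 1\<^sub>m N"
    by (auto simp: is_generalized_schur_form_def unitary_mat_def)
  have "?e = unit_vec N 0"
    using N by (intro eq_vecI) auto
  then have Ze: "Z *\<^sub>v ?e = col Z 0"
    using mat_mult_unit_vec[OF Z N] by (simp del: One_nat_def)
  have r: "?F *\<^sub>v col Z 0 \<in> carrier_vec N"
    by (rule mult_mat_vec_carrier[OF _ col_carrier_vec[OF N Z]]) (use A B in auto)
  obtain e where e: "mat_adjoint Q *\<^sub>v (?F *\<^sub>v (Z *\<^sub>v ?e)) = e @\<^sub>v (A1 - (\<beta> / \<alpha>) \<cdot>\<^sub>m B1) *\<^sub>v 0\<^sub>v (N - 1)"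
    "e = (\<beta> - (\<beta> / \<alpha>) * \<alpha>) \<cdot>\<^sub>v unit_vec 1 0"
    using schur_deflation[OF schur N A B, of "unit_vec 1 0" "0\<^sub>v (N - 1)" "\<beta> / \<alpha>"] by auto
  have "mat_adjoint Q *\<^sub>v (?F *\<^sub>v col Z 0) = 0\<^sub>v N"
  proof -
    have "(A1 - (\<beta> / \<alpha>) \<cdot>\<^sub>m B1) *\<^sub>v 0\<^sub>v (N - 1) = 0\<^sub>v (N - 1)"
      by (rule mat_mult_zero_vec[OF A1])
    then show ?thesis
      using e \<alpha> N unfolding Ze by (intro eq_vecI) auto
  qed
  then have "Q *\<^sub>v (mat_adjoint Q *\<^sub>v (?F *\<^sub>v col Z 0)) = 0\<^sub>v N"
    using Q by auto
  then show ?thesis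
    using assoc_mult_mat_vec[OF Q mat_adjoint_carrier[OF Q] r] QQ r by simp
qed

text \<open>With \<open>w = Z\<^sup>* v\<close>, subtracting \<open>w\<^sub>0 z\<close> from \<open>v\<close> removes the first coordinate and leaves a vector
  with the norm of the tail \<open>t\<close> of \<open>w\<close>. The tail of \<open>Q\<^sup>* (A - \<mu> B) v\<close> is \<open>(A\<^sub>1 - \<mu> B\<^sub>1) t\<close>, as the
  transformed matrix is block triangular, and applying the inverse of \<open>A\<^sub>1 - \<mu> B\<^sub>1\<close> bounds \<open>t\<close>.\<close>
lemma dist_to_schur_vector_le:
  assumes schur: "is_generalized_schur_form N A B Q Z \<alpha> \<beta> a b A1 B1" and N: "N > 0"
    and A: "A \<in> carrier_mat N N" and B: "B \<in> carrier_mat N N"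
    and inv: "invertible_mat (A1 - \<mu> \<cdot>\<^sub>m B1)"
    and v: "v \<in> carrier_vec N"
  obtains c where "norm2 (v - c \<cdot>\<^sub>v col Z 0) \<le> norm2 ((A - \<mu> \<cdot>\<^sub>m B) *\<^sub>v v) / sep \<mu> A1 B1"
proof -
  let ?F = "A - \<mu> \<cdot>\<^sub>m B" and ?F1 = "A1 - \<mu> \<cdot>\<^sub>m B1"
  from schur have Z: "Z \<in> carrier_mat N N" and Q: "Q \<in> carrier_mat N N"
    and A1: "A1 \<in> carrier_mat (N - 1) (N - 1)" and B1: "B1 \<in> carrier_mat (N - 1) (N - 1)"
    and ZZ: "mat_adjoint Z * Z = 1\<^sub>m N" "Z * mat_adjoint Z = 1\<^sub>m N"
    and QQ: "mat_adjoint Q * Q = 1\<^sub>m N" "Q * mat_adjoint Q = 1\<^sub>m N"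
    by (auto simp: is_generalized_schur_form_def unitary_mat_def)
  note Z' = mat_adjoint_carrier[OF Z] and Q' = mat_adjoint_carrier[OF Q]
  define w where "w = mat_adjoint Z *\<^sub>v v"
  have w: "w \<in> carrier_vec N"
    using Z' v by (simp add: w_def)
  have Zw: "Z *\<^sub>v w = v"
    using assoc_mult_mat_vec[OF Z Z' v] ZZ v by (simp add: w_def)
  define w1 where "w1 = vec_first w 1"
  define t where "t = vec_last w (N - 1)"
  have w1: "w1 \<in> carrier_vec 1" and t: "t \<in> carrier_vec (N - 1)"
    by (auto simp: w1_def t_def)
  have ww: "w = w1 @\<^sub>v t"
    using vec_first_last_append[of w 1 "N - 1"] w N by (simp add: w1_def t_def)
  obtain e where e: "e \<in> carrier_vec 1" "mat_adjoint Q *\<^sub>v (?F *\<^sub>v (Z *\<^sub>v (w1 @\<^sub>v t))) = e @\<^sub>v ?F1 *\<^sub>v t"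
    using schur_deflation[OF schur N A B w1 t, of \<mu>] by blast
  have r: "?F *\<^sub>v v \<in> carrier_vec N"
    by (rule mult_mat_vec_carrier[OF _ v]) (use A B in auto)
  have "norm2 (mat_adjoint Q *\<^sub>v (?F *\<^sub>v v)) = norm2 (Q *\<^sub>v (mat_adjoint Q *\<^sub>v (?F *\<^sub>v v)))"
    using norm2_isometry[OF Q QQ(1)] Q' r by simp
  also have "Q *\<^sub>v (mat_adjoint Q *\<^sub>v (?F *\<^sub>v v)) = ?F *\<^sub>v v"
    using assoc_mult_mat_vec[OF Q Q' r] QQ r by simp
  finally have "(norm2 (?F *\<^sub>v v))\<^sup>2 = (norm2 e)\<^sup>2 + (norm2 (?F1 *\<^sub>v t))\<^sup>2"
    using e(2) norm2_append[of e "?F1 *\<^sub>v t"] unfolding ww[symmetric] Zw by simp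
  then have "(norm2 (?F1 *\<^sub>v t))\<^sup>2 \<le> (norm2 (?F *\<^sub>v v))\<^sup>2"
    using zero_le_power2[of "norm2 e"] by linarith
  then have tail: "norm2 (?F1 *\<^sub>v t) \<le> norm2 (?F *\<^sub>v v)"
    using norm2_nonneg by (rule power2_le_imp_le)
  obtain K where K: "K \<in> carrier_mat (N - 1) (N - 1)" "K * ?F1 = 1\<^sub>m (N - 1)"
    and sepK: "sep \<mu> A1 B1 = inverse (mat_norm2 K)"
    using sep_invertible[OF A1 B1 inv] by blast
  have F1: "?F1 \<in> carrier_mat (N - 1) (N - 1)"
    using A1 B1 by auto
  have "t = K *\<^sub>v (?F1 *\<^sub>v t)"
    using assoc_mult_mat_vec[OF K(1) F1 t] K(2) t by simp
  then have "norm2 t = norm2 (K *\<^sub>v (?F1 *\<^sub>v t))"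
    by simp
  also have "\<dots> \<le> mat_norm2 K * norm2 (?F1 *\<^sub>v t)"
    using mat_norm2_bound[OF K(1)] F1 t by simp
  also have "\<dots> \<le> mat_norm2 K * norm2 (?F *\<^sub>v v)"
    using tail mat_norm2_nonneg[OF K(1)] by (rule mult_left_mono)
  finally have nt: "norm2 t \<le> norm2 (?F *\<^sub>v v) / sep \<mu> A1 B1"
    by (simp add: sepK divide_inverse mult.commute)
  define c where "c = w1 $ 0"
  have e0: "unit_vec N 0 \<in> carrier_vec N"
    by simp
  have "v - c \<cdot>\<^sub>v col Z 0 = Z *\<^sub>v (w - c \<cdot>\<^sub>v unit_vec N 0)"
    using mult_minus_distrib_mat_vec[OF Z w, of "c \<cdot>\<^sub>v unit_vec N 0"] mult_mat_vec[OF Z e0, of c] N Z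
    by (simp add: Zw mat_mult_unit_vec[OF Z N])
  also have "w - c \<cdot>\<^sub>v unit_vec N 0 = 0\<^sub>v 1 @\<^sub>v t"
    using w1 t N unfolding ww by (intro eq_vecI) (auto simp: c_def)
  finally have "norm2 (v - c \<cdot>\<^sub>v col Z 0) = norm2 (0\<^sub>v 1 @\<^sub>v t)"
    using norm2_isometry[OF Z ZZ(1), of "0\<^sub>v 1 @\<^sub>v t"] append_carrier_vec[of "0\<^sub>v 1" 1 t "N - 1"] t N by simp
  also have "\<dots> = norm2 t"
    using norm2_append[of "0\<^sub>v 1" t] by (simp add: norm2_zero norm2_nonneg)
  finally show ?thesis
    using nt that[of c] by simp
qed

section \<open>The angle bound\<close>

lemma norm2_recovered_vec_le:
  assumes v: "v \<in> carrier_vec m" and i: "i * n + n \<le> m"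
  shows "norm2 (recovered_vec n i v) \<le> norm2 v"
proof (rule power2_le_imp_le)
  have "(norm2 (recovered_vec n i v))\<^sup>2 = (\<Sum>l\<in>(\<lambda>r. i * n + r) ` {..<n}. (cmod (v $ l))\<^sup>2)"
    by (subst sum.reindex) (auto simp: norm2_sq recovered_vec_def inj_on_def)
  also have "\<dots> \<le> (norm2 v)\<^sup>2"
    unfolding norm2_sq using v i by (intro sum_mono2) auto
  finally show "(norm2 (recovered_vec n i v))\<^sup>2 \<le> (norm2 v)\<^sup>2" .
qed (rule norm2_nonneg)

theorem theorem5p2:
  fixes n d \<epsilon> \<eta> :: nat
    and C :: "nat \<Rightarrow> complex mat"
    and P :: "complex poly mat"
    and A B Q Z A1 B1 :: "complex mat"
    and x x' a b :: "complex vec"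
    and \<mu> \<mu>' \<alpha> \<beta> :: complex
  assumes C: "\<And>i. i \<le> d \<Longrightarrow> C i \<in> carrier_mat n n"
    and P: "P = matrix_poly n d C"
    and degree: "C d \<noteq> 0\<^sub>m n n"
    and regular: "regular_mat_poly P"
    and d: "d = \<epsilon> + \<eta> + 1"
    and A: "A \<in> carrier_mat (d * n) (d * n)"
    and B: "B \<in> carrier_mat (d * n) (d * n)"
    and linearization: "is_block_kronecker_linearization n \<epsilon> \<eta> P (pencil A B)"
    and exact: "eigenpair P \<mu> x"
    and approx: "x' \<in> carrier_vec n"
    and unit: "norm2 x = 1" "norm2 x' = 1"
    and schur: "is_generalized_schur_form (d * n) A B Q Z \<alpha> \<beta> a b A1 B1"
    and eigenvalue: "\<alpha> \<noteq> 0" "\<mu> = \<beta> / \<alpha>"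
    and associated: "(\<forall>y. eigenpair P \<mu> y \<longrightarrow> (\<exists>c. y = c \<cdot>\<^sub>v x))
                     \<or> (\<exists>c. recovered_vec n \<epsilon> (col Z 0) = c \<cdot>\<^sub>v x)"
    and nonsingular: "invertible_mat (A1 - \<mu>' \<cdot>\<^sub>m B1)"
  shows "sin (acute_angle x x')
           \<le> norm2 (eval_mat P \<mu>' *\<^sub>v x') / (max 1 (cmod \<mu>' ^ (d - 1)) * sep \<mu>' A1 B1)"
proof -
  have dimP: "dim_row P = n" "dim_col P = n"
    by (simp_all add: P matrix_poly_def)
  have x: "x \<in> carrier_vec n"
    using exact by (simp add: eigenpair_def dimP)
  have "n \<noteq> 0"
    using x unit(1) by (metis carrier_vecD eq_vecI index_zero_vec(2) norm2_zero not_less_zero zero_neq_one)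
  then have N: "d * n > 0"
    by (simp add: d)
  define z where "z = col Z 0"
  have z: "z \<in> carrier_vec (d * n)"
    using schur col_carrier_vec[OF N] by (auto simp: z_def is_generalized_schur_form_def unitary_mat_def)
  have "(A - \<mu> \<cdot>\<^sub>m B) *\<^sub>v z = 0\<^sub>v (d * n)"
    using schur_null_vector[OF schur N A B eigenvalue(1)] by (simp add: z_def eigenvalue(2))
  note null = block_kronecker_null_vector[OF linearization A[unfolded d] B[unfolded d] z[unfolded d]
      this[unfolded d]]
  \<comment> \<open>A nonzero block is an eigenvector, to which the assumption on the eigenspace applies; a zero block
    is the trivial multiple of \<open>x\<close>.\<close>
  have "\<exists>c. recovered_vec n \<epsilon> z = c \<cdot>\<^sub>v x"
  proof (cases "recovered_vec n \<epsilon> z = 0\<^sub>v n")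
    case True
    then have "recovered_vec n \<epsilon> z = 0 \<cdot>\<^sub>v x"
      using x by (intro eq_vecI) auto
    then show ?thesis ..
  next
    case False
    then have "eigenpair P \<mu> (recovered_vec n \<epsilon> z)"
      using null(1) by (simp add: eigenpair_def dimP) (simp add: recovered_vec_def)
    then show ?thesis
      using associated by (auto simp: z_def)
  qed
  then obtain c0 where c0: "recovered_vec n \<epsilon> z = c0 \<cdot>\<^sub>v x" ..
  \<comment> \<open>The estimate seen from block \<open>i\<close> of the vectors and block \<open>j\<close> of the residual.\<close>
  have key: "cmod \<mu>' ^ (\<epsilon> - i) * sin (acute_angle x x')
      \<le> cmod s * norm2 (eval_mat P \<mu>' *\<^sub>v x') / sep \<mu>' A1 B1"
    if i: "i < \<epsilon> + 1" and j: "j < \<eta> + 1" and s: "s * \<mu>' ^ (\<eta> - j) = 1" for i j s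
  proof -
    obtain v where v: "v \<in> carrier_vec (d * n)"
      and v_block: "recovered_vec n i v = \<mu>' ^ (\<epsilon> - i) \<cdot>\<^sub>v x'"
      and res: "norm2 ((A - \<mu>' \<cdot>\<^sub>m B) *\<^sub>v v) = cmod s * norm2 (eval_mat P \<mu>' *\<^sub>v x')"
      using block_kronecker_lift[OF linearization A[unfolded d] B[unfolded d] approx j s] i
      unfolding d by metis
    obtain c where c: "norm2 (v - c \<cdot>\<^sub>v z) \<le> cmod s * norm2 (eval_mat P \<mu>' *\<^sub>v x') / sep \<mu>' A1 B1"
      using dist_to_schur_vector_le[OF schur N A B nonsingular v] unfolding res z_def by blast
    have im: "i * n + n \<le> d * n"
      using mult_le_mono1[of "i + 1" d n] i by (simp add: d)
    have "recovered_vec n i (v - c \<cdot>\<^sub>v z) = recovered_vec n i v - c \<cdot>\<^sub>v recovered_vec n i z"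
      using v z im by (intro eq_vecI) (auto simp: recovered_vec_def)
    also have "\<dots> = \<mu>' ^ (\<epsilon> - i) \<cdot>\<^sub>v x' - (c * \<mu> ^ (\<epsilon> - i) * c0) \<cdot>\<^sub>v x"
      by (simp add: v_block null(2)[OF i] c0 smult_smult_assoc mult.assoc)
    finally have "norm2 (\<mu>' ^ (\<epsilon> - i) \<cdot>\<^sub>v x' - (c * \<mu> ^ (\<epsilon> - i) * c0) \<cdot>\<^sub>v x) \<le> norm2 (v - c \<cdot>\<^sub>v z)"
      using norm2_recovered_vec_le[of "v - c \<cdot>\<^sub>v z" "d * n" i n] v z im by simp
    then show ?thesis
      using sin_acute_angle_le_dist[OF approx unit(2) x unit(1), of "\<mu>' ^ (\<epsilon> - i)" "c * \<mu> ^ (\<epsilon> - i) * c0"] c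
      by (simp add: norm_power)
  qed
  show ?thesis
  proof (cases "cmod \<mu>' \<le> 1")
    case True
    then have "max 1 (cmod \<mu>' ^ (d - 1)) = 1"
      by (intro max_absorb1 power_le_one) auto
    then show ?thesis
      using key[of \<epsilon> \<eta> 1] by simp
  next
    case False
    then have ne: "\<mu>' \<noteq> 0"
      by auto
    from False have max: "max 1 (cmod \<mu>' ^ (d - 1)) = cmod \<mu>' ^ \<epsilon> * cmod \<mu>' ^ \<eta>"
      by (simp add: d power_add one_le_power max_absorb2 flip: power_add)
    have "cmod \<mu>' ^ \<epsilon> * sin (acute_angle x x')
        \<le> inverse (cmod \<mu>' ^ \<eta>) * norm2 (eval_mat P \<mu>' *\<^sub>v x') / sep \<mu>' A1 B1"
      using key[of 0 0 "inverse (\<mu>' ^ \<eta>)"] ne by (simp add: norm_inverse norm_power)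
    then have "sin (acute_angle x x')
        \<le> (inverse (cmod \<mu>' ^ \<eta>) * norm2 (eval_mat P \<mu>' *\<^sub>v x') / sep \<mu>' A1 B1) / cmod \<mu>' ^ \<epsilon>"
      using ne by (subst pos_le_divide_eq) (auto simp: mult.commute)
    then show ?thesis
      unfolding max by (simp add: divide_inverse ac_simps)
  qed
qed

end
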